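(* Consider the semilinear system $\dot x(t)=Ax(t)+f(t,x(t),u(t))$, $x(t_0)=x_0$, on the Banach space $\mathcal X$, where $A$ generates a $C_0$-semigroup $T(\cdot)$ on $\mathcal X$ and $f:\mathbb R_{\ge0}\times\mathcal X\times\mathsf U\to\mathcal X$. Suppose that: (SL1) there exist a strictly increasing unbounded sequence of positive times $\{\tau_k\}_{k=1}^\infty$ and continuous functions $f_k:[\tau_k,\tau_{k+1}]\times\mathcal X\times\mathsf U\to\mathcal X$, $k=0,1,\dots$, with $\tau_0=0$, such that $f=f_k$ on $[\tau_k,\tau_{k+1})\times\mathcal X\times\mathsf U$; (SL2) for all $r>0$ there exists $L=L(r)\ge0$ such that $\|f(t,\xi,\mu)-f(t,\omega,\mu)\|_{\mathcal X}\le L\|\xi-\omega\|_{\mathcal X}$ for all $t\ge0$, all $\xi,\omega\in\mathcal X$ with norms $\le r$ and all $\mu\in\mathsf U$ with $\|\mu\|_{\mathsf U}\le r$; and that there exist constants $K,d\ge0$ and $\gamma\in\mathcal K_\infty$ such that $$\|f(t,\xi,\mu)\|_{\mathcal X}\le(K\|\xi\|_{\mathcal X}+d)\,\gamma(\|\mu\|_{\mathsf U})\quad\text{for all }t\ge0,\ \xi\in\mathcal X,\ \mu\in\mathsf U.$$ Then the following are equivalent: a) the system is iISS; b) the system is 0-GUAS.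
   Context: Comparison functions. $\alpha\in\mathcal K$ if $\alpha:\mathbb R_{\ge0}\to\mathbb R_{\ge0}$ is continuous, strictly increasing, $\alpha(0)=0$; $\alpha\in\mathcal K_\infty$ if moreover unbounded. $\beta\in\mathcal{KL}$ if $\beta:\mathbb R_{\ge0}\times\mathbb R_{\ge0}\to\mathbb R_{\ge0}$, $\beta(\cdot,t)\in\mathcal K$ for each $t\ge0$, and for each fixed $r\ge0$, $\beta(r,t)$ decreases monotonically to $0$ as $t\to\infty$. Convention: $\rho(\infty)=\infty$ for $\rho\in\mathcal K_\infty$. Setting. $\mathcal X$ is a Banach space with norm $\|\cdot\|_{\mathcal X}$, $\mathsf U$ a normed space with norm $\|\cdot\|_{\mathsf U}$. The admissible inputs $\mathcal U$ are all piecewise continuous functions $u:\mathbb R_{\ge0}\to\mathsf U$ (finitely many discontinuities on each bounded interval, with one-sided limits there); $\mathbf 0$ is the zero input. A weak solution on $J=[t_0,\tau)$ or $[t_0,\tau]$ is a continuous $x:J\to\mathcal X$ with $x(t)=T(t-t_0)x_0+\int_{t_0}^tT(t-s)f(s,x(s),u(s))\,ds$ for all $t\in J$ (Bochner integral). Under the stated hypotheses, for every $t_0\ge0$, $x_0\in\mathcal X$, $u\in\mathcal U$ there is a unique maximally defined weak solution $x:[t_0,t_{(t_0,x_0,u)})\to\mathcal X$; write $\phi(t,t_0,x_0,u)=x(t)$. The system is forward complete if $t_{(t_0,x_0,u)}=\infty$ always. For $\kappa\in\mathcal K_\infty$, $\|u\|_\kappa=\int_0^\infty\kappa(\|u(s)\|_{\mathsf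 U})\,ds\in[0,\infty]$. Stability notions. 0-GUAS: there is $\beta\in\mathcal{KL}$ such that for all $t_0\ge0$, $x_0\in\mathcal X$, $\phi(t,t_0,x_0,\mathbf 0)$ is defined for all $t\ge t_0$ and $\|\phi(t,t_0,x_0,\mathbf 0)\|_{\mathcal X}\le\beta(\|x_0\|_{\mathcal X},t-t_0)$. iISS: the system is forward complete and there are $\kappa,\rho\in\mathcal K_\infty$ and $\beta\in\mathcal{KL}$ such that $\|\phi(t,t_0,x_0,u)\|_{\mathcal X}\le\beta(\|x_0\|_{\mathcal X},t-t_0)+\rho(\|u\|_\kappa)$ for all $t\ge t_0\ge0$, $x_0\in\mathcal X$, $u\in\mathcal U$. *)

theory Defs
  imports "HOL-Analysis.Analysis"
begin

section \<open>Comparison functions\<close>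

text \<open>Functions on the nonnegative reals are rendered as functions on \<^typ>\<open>real\<close> of which
  only the values at nonnegative arguments matter.\<close>

definition class_K :: "(real \<Rightarrow> real) \<Rightarrow> bool" where
  "class_K \<alpha> \<longleftrightarrow> continuous_on {0..} \<alpha> \<and> strict_mono_on {0..} \<alpha> \<and> \<alpha> 0 = 0"

definition class_K_inf :: "(real \<Rightarrow> real) \<Rightarrow> bool" where
  "class_K_inf \<alpha> \<longleftrightarrow> class_K \<alpha> \<and> \<not> bdd_above (\<alpha> ` {0..})"

definition class_KL :: "(real \<Rightarrow> real \<Rightarrow> real) \<Rightarrow> bool" where
  "class_KL \<beta> \<longleftrightarrow>
     (\<forall>t\<ge>0. class_K (\<lambda>r. \<beta> r t)) \<and>
     (\<forall>r\<ge>0. antimono_on {0..} (\<beta> r) \<and> (\<beta> r \<longlongrightarrow> 0) at_top)"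

text \<open>Extension by the convention that the value at infinity is infinity.\<close>

definition extend_top :: "(real \<Rightarrow> real) \<Rightarrow> ennreal \<Rightarrow> ennreal" where
  "extend_top \<rho> z = (if z = \<infinity> then \<infinity> else ennreal (\<rho> (enn2real z)))"

section \<open>Strongly continuous semigroups\<close>

definition C0_semigroup :: "(real \<Rightarrow> 'x::banach \<Rightarrow>\<^sub>L 'x) \<Rightarrow> bool" where
  "C0_semigroup T \<longleftrightarrow>
     T 0 = id_blinfun \<and>
     (\<forall>s\<ge>0. \<forall>t\<ge>0. T (s + t) = T s o\<^sub>L T t) \<and>
     (\<forall>\<xi>. ((\<lambda>t. blinfun_apply (T t) \<xi>) \<longlongrightarrow> \<xi>) (at_right 0))"

text \<open>An unbounded operator is given by its domain \<open>D\<close> and a function \<open>A\<close> whose values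
  outside \<open>D\<close> are irrelevant.\<close>

definition generates ::
    "'x set \<Rightarrow> ('x \<Rightarrow> 'x) \<Rightarrow> (real \<Rightarrow> 'x::banach \<Rightarrow>\<^sub>L 'x) \<Rightarrow> bool" where
  "generates D A T \<longleftrightarrow>
     C0_semigroup T \<and>
     D = {\<xi>. \<exists>\<eta>. ((\<lambda>h. (blinfun_apply (T h) \<xi> - \<xi>) /\<^sub>R h) \<longlongrightarrow> \<eta>) (at_right 0)} \<and>
     (\<forall>\<xi>\<in>D. ((\<lambda>h. (blinfun_apply (T h) \<xi> - \<xi>) /\<^sub>R h) \<longlongrightarrow> A \<xi>) (at_right 0))"

section \<open>Bochner integral\<close>

text \<open>The library's \<^const>\<open>has_bochner_integral\<close> is confined to second countable codomains.
  This version is for arbitrary Banach spaces: Borel measurability of the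
  integrand is replaced by strong measurability, i.e. almost everywhere approximation by
  simple functions. It is intended for complete measures, where this makes
  \<open>norm (g z - s i z)\<close> measurable.\<close>

definition has_bochner_integral_banach ::
    "'a measure \<Rightarrow> ('a \<Rightarrow> 'x::banach) \<Rightarrow> 'x \<Rightarrow> bool" where
  "has_bochner_integral_banach M g I \<longleftrightarrow>
     (\<exists>s. (\<forall>i::nat. Bochner_Integration.simple_bochner_integrable M (s i)) \<and>
          (AE z in M. (\<lambda>i. s i z) \<longlonglongrightarrow> g z) \<and>
          (\<lambda>i. \<integral>\<^sup>+ z. ennreal (norm (g z - s i z)) \<partial>M) \<longlonglongrightarrow> 0 \<and>
          (\<lambda>i. Bochner_Integration.simple_bochner_integral M (s i)) \<longlonglongrightarrow> I)"

section \<open>Admissible inputs\<close>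

text \<open>An input is a function on \<open>{0..}\<close>; hence continuity is taken within \<open>{0..}\<close> and no
  left limit is asked for at \<open>0\<close>.\<close>

definition input_discontinuities :: "(real \<Rightarrow> 'u::real_normed_vector) \<Rightarrow> real set" where
  "input_discontinuities u = {s. 0 \<le> s \<and> \<not> continuous (at s within {0..}) u}"

definition admissible_input :: "(real \<Rightarrow> 'u::real_normed_vector) \<Rightarrow> bool" where
  "admissible_input u \<longleftrightarrow>
     (\<forall>b. finite (input_discontinuities u \<inter> {0..b})) \<and>
     (\<forall>s\<in>input_discontinuities u.
        (\<exists>l. (u \<longlongrightarrow> l) (at_right s)) \<and> (0 < s \<longrightarrow> (\<exists>l. (u \<longlongrightarrow> l) (at_left s))))"

definition input_norm :: "(real \<Rightarrow> real) \<Rightarrow> (real \<Rightarrow> 'u::real_normed_vector) \<Rightarrow> ennreal" where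
  "input_norm \<kappa> u = (\<integral>\<^sup>+ s\<in>{0..}. ennreal (\<kappa> (norm (u s))) \<partial>lebesgue)"

section \<open>Conditions on the nonlinearity\<close>

definition SL1 :: "(real \<Rightarrow> 'x::banach \<Rightarrow> 'u::real_normed_vector \<Rightarrow> 'x) \<Rightarrow> bool" where
  "SL1 f \<longleftrightarrow>
     (\<exists>(\<tau> :: nat \<Rightarrow> real) (fk :: nat \<Rightarrow> real \<Rightarrow> 'x \<Rightarrow> 'u \<Rightarrow> 'x).
        \<tau> 0 = 0 \<and> strict_mono \<tau> \<and> \<not> bdd_above (range \<tau>) \<and>
        (\<forall>k. continuous_on ({\<tau> k..\<tau> (Suc k)} \<times> UNIV \<times> UNIV) (\<lambda>(t, \<xi>, \<mu>). fk k t \<xi> \<mu>)) \<and>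
        (\<forall>k. \<forall>t\<in>{\<tau> k..<\<tau> (Suc k)}. \<forall>\<xi> \<mu>. f t \<xi> \<mu> = fk k t \<xi> \<mu>))"

definition SL2 :: "(real \<Rightarrow> 'x::banach \<Rightarrow> 'u::real_normed_vector \<Rightarrow> 'x) \<Rightarrow> bool" where
  "SL2 f \<longleftrightarrow>
     (\<forall>r>0. \<exists>L\<ge>0. \<forall>t\<ge>0. \<forall>\<xi> \<omega> \<mu>.
        norm \<xi> \<le> r \<and> norm \<omega> \<le> r \<and> norm \<mu> \<le> r \<longrightarrow>
        norm (f t \<xi> \<mu> - f t \<omega> \<mu>) \<le> L * norm (\<xi> - \<omega>))"

section \<open>Weak solutions\<close>

definition half_open_interval :: "real \<Rightarrow> ereal \<Rightarrow> real set" where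
  "half_open_interval t0 \<tau> = {t. t0 \<le> t \<and> ereal t < \<tau>}"

definition solution_interval :: "real \<Rightarrow> real set \<Rightarrow> bool" where
  "solution_interval t0 J \<longleftrightarrow>
     (\<exists>\<tau>::ereal. ereal t0 < \<tau> \<and> J = half_open_interval t0 \<tau>) \<or>
     (\<exists>\<tau>::real. t0 < \<tau> \<and> J = {t0..\<tau>})"

text \<open>Weak solutions of \<open>x' = A x + f t x u\<close>, \<open>x t0 = x0\<close>, where \<open>A\<close> generates \<open>T\<close>.\<close>

definition weak_solution ::
    "(real \<Rightarrow> 'x::banach \<Rightarrow>\<^sub>L 'x) \<Rightarrow> (real \<Rightarrow> 'x \<Rightarrow> 'u::real_normed_vector \<Rightarrow> 'x) \<Rightarrow>
     real \<Rightarrow> 'x \<Rightarrow> (real \<Rightarrow> 'u) \<Rightarrow> real set \<Rightarrow> (real \<Rightarrow> 'x) \<Rightarrow> bool" where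
  "weak_solution T f t0 x0 u J x \<longleftrightarrow>
     solution_interval t0 J \<and> continuous_on J x \<and>
     (\<forall>t\<in>J. \<exists>I.
        has_bochner_integral_banach (lebesgue_on {t0..t})
          (\<lambda>s. blinfun_apply (T (t - s)) (f s (x s) (u s))) I \<and>
        x t = blinfun_apply (T (t - t0)) x0 + I)"

definition maximal_weak_solution ::
    "(real \<Rightarrow> 'x::banach \<Rightarrow>\<^sub>L 'x) \<Rightarrow> (real \<Rightarrow> 'x \<Rightarrow> 'u::real_normed_vector \<Rightarrow> 'x) \<Rightarrow>
     real \<Rightarrow> 'x \<Rightarrow> (real \<Rightarrow> 'u) \<Rightarrow> ereal \<Rightarrow> (real \<Rightarrow> 'x) \<Rightarrow> bool" where
  "maximal_weak_solution T f t0 x0 u \<tau> x \<longleftrightarrow>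
     ereal t0 < \<tau> \<and>
     weak_solution T f t0 x0 u (half_open_interval t0 \<tau>) x \<and>
     (\<forall>J y. weak_solution T f t0 x0 u J y \<and> half_open_interval t0 \<tau> \<subseteq> J \<and>
        (\<forall>t\<in>half_open_interval t0 \<tau>. y t = x t) \<longrightarrow> J = half_open_interval t0 \<tau>)"

text \<open>For a \<open>C0\<close>-semigroup \<open>T\<close>, under \<^const>\<open>SL1\<close> and \<^const>\<open>SL2\<close>, for \<open>t0 \<ge> 0\<close> and an admissible input, the maximal
  solution exists and is unique, so that the following descriptions denote its end time and, for
  times \<open>t\<close> in its interval of definition, its value.\<close>

definition end_time ::
    "(real \<Rightarrow> 'x::banach \<Rightarrow>\<^sub>L 'x) \<Rightarrow> (real \<Rightarrow> 'x \<Rightarrow> 'u::real_normed_vector \<Rightarrow> 'x) \<Rightarrow>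
     real \<Rightarrow> 'x \<Rightarrow> (real \<Rightarrow> 'u) \<Rightarrow> ereal" where
  "end_time T f t0 x0 u = (THE \<tau>. \<exists>x. maximal_weak_solution T f t0 x0 u \<tau> x)"

definition flow ::
    "(real \<Rightarrow> 'x::banach \<Rightarrow>\<^sub>L 'x) \<Rightarrow> (real \<Rightarrow> 'x \<Rightarrow> 'u::real_normed_vector \<Rightarrow> 'x) \<Rightarrow>
     real \<Rightarrow> real \<Rightarrow> 'x \<Rightarrow> (real \<Rightarrow> 'u) \<Rightarrow> 'x" where
  "flow T f t t0 x0 u =
     (THE v. \<exists>\<tau> x. maximal_weak_solution T f t0 x0 u \<tau> x \<and> t \<in> half_open_interval t0 \<tau> \<and> v = x t)"

section \<open>Stability notions\<close>

definition forward_complete ::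
    "(real \<Rightarrow> 'x::banach \<Rightarrow>\<^sub>L 'x) \<Rightarrow> (real \<Rightarrow> 'x \<Rightarrow> 'u::real_normed_vector \<Rightarrow> 'x) \<Rightarrow> bool" where
  "forward_complete T f \<longleftrightarrow>
     (\<forall>t0\<ge>0. \<forall>x0 u. admissible_input u \<longrightarrow> end_time T f t0 x0 u = \<infinity>)"

definition zero_GUAS ::
    "(real \<Rightarrow> 'x::banach \<Rightarrow>\<^sub>L 'x) \<Rightarrow> (real \<Rightarrow> 'x \<Rightarrow> 'u::real_normed_vector \<Rightarrow> 'x) \<Rightarrow> bool" where
  "zero_GUAS T f \<longleftrightarrow>
     (\<exists>\<beta>. class_KL \<beta> \<and>
        (\<forall>t0\<ge>0. \<forall>x0.
           end_time T f t0 x0 (\<lambda>_. 0) = \<infinity> \<and>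
           (\<forall>t\<ge>t0. norm (flow T f t t0 x0 (\<lambda>_. 0)) \<le> \<beta> (norm x0) (t - t0))))"

definition iISS ::
    "(real \<Rightarrow> 'x::banach \<Rightarrow>\<^sub>L 'x) \<Rightarrow> (real \<Rightarrow> 'x \<Rightarrow> 'u::real_normed_vector \<Rightarrow> 'x) \<Rightarrow> bool" where
  "iISS T f \<longleftrightarrow>
     forward_complete T f \<and>
     (\<exists>\<kappa> \<rho> \<beta>. class_K_inf \<kappa> \<and> class_K_inf \<rho> \<and> class_KL \<beta> \<and>
        (\<forall>t0\<ge>0. \<forall>t\<ge>t0. \<forall>x0 u. admissible_input u \<longrightarrow>
           ennreal (norm (flow T f t t0 x0 u))
             \<le> ennreal (\<beta> (norm x0) (t - t0)) + extend_top \<rho> (input_norm \<kappa> u)))"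

end

theory Submission
  imports Defs
begin

text \<open>
The growth bound forces \<open>f t \<xi> 0 = 0\<close>, because \<open>\<gamma> 0 = 0\<close>. Without input the system is therefore the
linear equation \<open>x' = A x\<close>, and its flow is the semigroup. For a linear flow, uniform global asymptotic
stability is exponential stability: by homogeneity \<open>norm (T t) \<le> \<beta> 1 t\<close>, the right hand side
drops below \<open>1/2\<close> at some time \<open>p\<close>, and the semigroup law then gives
\<open>norm (T t) \<le> M * exp (- \<nu> * t)\<close> (\<open>zero_GUAS_imp_exponentially_stable\<close>).

With an input \<open>u\<close>, the variation of constants formula and Gronwall's lemma, applied to the solution
weighted by \<open>exp (\<nu> * (t - t0))\<close>, yield
\<open>norm (x t) \<le> (y + M * d * G) * exp (M * K * G)\<close>, where \<open>y = M * exp (- \<nu> * (t - t0)) * norm x0\<close> and \<open>G\<close> is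
the integral of \<open>\<gamma> (norm (u s))\<close> over \<open>{t0..t}\<close> (\<open>weak_solution_exponential_estimate\<close>). The mixed term
\<open>y * exp (M * K * G)\<close> is \<open>y + y * (exp (M * K * G) - 1)\<close>, and \<open>a * b \<le> a\<^sup>2 / 2 + b\<^sup>2 / 2\<close> separates it
into a function of class KL of initial norm and elapsed time and a gain of \<open>G\<close>. As \<open>G\<close> is at most the
input norm for \<open>\<kappa> = \<gamma>\<close>, this is the iISS estimate. The other implication is the case \<open>u = 0\<close>.

Both estimates speak of the maximal solution, so that well-posedness has to be established.
Integrands have one-sided limits everywhere, hence are uniform limits of step functions, and their
Bochner integrals are Henstock-Kurzweil integrals. Since \<open>f\<close> grows at most linearly in the state for
bounded inputs, a weighted contraction argument gives a solution on each compact interval in one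
step (\<open>volterra_fixed_point\<close>, \<open>weak_solution_exists_compact\<close>). By uniqueness these solutions fit
together to a solution on \<open>{t0..}\<close>, which then is the only maximal one (\<open>global_weak_solution_flow\<close>).
Continuity of solutions rests on the strong continuity of the semigroup at all times, for which the
principle of uniform boundedness is used.
\<close>

section \<open>Regulated functions\<close>

text \<open>Existence of one-sided limits is all that is retained of the piecewise continuity of inputs and
of \<open>f\<close> in time: it passes through continuous maps point by point, without any record of where
the break points of a composition lie, and it still yields uniform approximation by step
functions.\<close>

definition regulated_on :: "real \<Rightarrow> real \<Rightarrow> (real \<Rightarrow> 'a::topological_space) \<Rightarrow> bool" where
  "regulated_on a b h \<longleftrightarrow>
     (\<forall>s. a \<le> s \<and> s < b \<longrightarrow> (\<exists>l. (h \<longlongrightarrow> l) (at_right s))) \<and>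
     (\<forall>s. a < s \<and> s \<le> b \<longrightarrow> (\<exists>l. (h \<longlongrightarrow> l) (at_left s)))"

lemma regulated_on_subinterval:
  assumes "regulated_on a b h" "a \<le> c" "d \<le> b"
  shows "regulated_on c d h"
  using assms unfolding regulated_on_def by auto

lemma continuous_on_imp_regulated_on:
  assumes "continuous_on {a..b} h"
  shows "regulated_on a b h"
proof -
  have "(h \<longlongrightarrow> h s) (at_right s)" if "a \<le> s" "s < b" for s
  proof -
    have "continuous_on {s..b} h"
      using assms that by (auto intro: continuous_on_subset)
    then have "(h \<longlongrightarrow> h s) (at s within {s..b})"
      using that by (simp add: continuous_on_def)
    then show ?thesis
      using that by (simp add: at_within_Icc_at_right)
  qed
  moreover have "(h \<longlongrightarrow> h s) (at_left s)" if "a < s" "s \<le> b" for s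
  proof -
    have "continuous_on {a..s} h"
      using assms that by (auto intro: continuous_on_subset)
    then have "(h \<longlongrightarrow> h s) (at s within {a..s})"
      using that by (simp add: continuous_on_def)
    then show ?thesis
      using that by (simp add: at_within_Icc_at_left)
  qed
  ultimately show ?thesis
    unfolding regulated_on_def by blast
qed

text \<open>A function inherits one-sided limits from two others as soon as its limit along every filter
can be computed from theirs.\<close>

lemma regulated_on_combine:
  assumes "regulated_on a b g" "regulated_on a b h"
    and "\<And>F l m. (g \<longlongrightarrow> l) F \<Longrightarrow> (h \<longlongrightarrow> m) F \<Longrightarrow> \<exists>k. (\<phi> \<longlongrightarrow> k) F"
  shows "regulated_on a b \<phi>"
  using assms unfolding regulated_on_def by blast

lemma regulated_on_compose_continuous:
  assumes "regulated_on a b h" "continuous_on UNIV g"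
  shows "regulated_on a b (\<lambda>s. g (h s))"
proof (rule regulated_on_combine[OF assms(1) assms(1)])
  fix F l
  assume "(h \<longlongrightarrow> l) F"
  then have "((\<lambda>s. g (h s)) \<longlongrightarrow> g l) F"
    by (intro continuous_on_tendsto_compose[OF assms(2)]) auto
  then show "\<exists>k. ((\<lambda>s. g (h s)) \<longlongrightarrow> k) F"
    by blast
qed

lemma regulated_on_mult:
  fixes g h :: "real \<Rightarrow> real"
  assumes "regulated_on a b g" "regulated_on a b h"
  shows "regulated_on a b (\<lambda>s. g s * h s)"
  by (rule regulated_on_combine[OF assms]) (blast intro: tendsto_mult)

lemma regulated_on_diff:
  fixes g h :: "real \<Rightarrow> 'a::real_normed_vector"
  assumes "regulated_on a b g" "regulated_on a b h"
  shows "regulated_on a b (\<lambda>s. g s - h s)"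
  by (rule regulated_on_combine[OF assms]) (blast intro: tendsto_diff)

text \<open>Being approximable within \<open>e\<close> on \<open>{c..d}\<close> is additive in the interval, and near a point \<open>x\<close> three
constants suffice: the limits of \<open>h\<close> from the left and from the right, and the value at \<open>x\<close>.
Bisection of \<open>{a..b}\<close> turns this local fact into a global one.\<close>

lemma regulated_on_step_approximation:
  fixes h :: "real \<Rightarrow> 'a::real_normed_vector"
  assumes reg: "regulated_on a b h" and "e > 0"
  obtains s where "simple_function borel s" "\<And>z. z \<in> {a..b} \<Longrightarrow> norm (h z - s z) \<le> e"
proof (cases "a \<le> b")
  case False
  then show ?thesis
    using that[of "\<lambda>_. 0"] by simp
next
  case True
  define P where "P c d \<longleftrightarrow>
    (\<exists>s. simple_function borel s \<and> (\<forall>z\<in>{a..b} \<inter> {c..d}. norm (h z - s z) \<le> e))" for c d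
  have "P a b"
    using \<open>a \<le> b\<close>
  proof (induction rule: Bolzano)
    case (trans p q r)
    then obtain s1 s2 where s: "simple_function borel s1" "simple_function borel s2"
      and "\<forall>z\<in>{a..b} \<inter> {p..q}. norm (h z - s1 z) \<le> e"
        "\<forall>z\<in>{a..b} \<inter> {q..r}. norm (h z - s2 z) \<le> e"
      unfolding P_def by blast
    then have "\<forall>z\<in>{a..b} \<inter> {p..r}. norm (h z - (if z \<le> q then s1 z else s2 z)) \<le> e"
      by auto
    moreover have "simple_function borel (\<lambda>z. if z \<le> q then s1 z else s2 z)"
      by (rule simple_function_If[OF s]) simp
    ultimately show ?case
      unfolding P_def by blast
  next
    case (local x)
    obtain l1 d1 where 1: "d1 > 0" "\<And>z. a \<le> z \<Longrightarrow> z < x \<Longrightarrow> x - d1 < z \<Longrightarrow> norm (h z - l1) \<le> e"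
    proof (cases "a < x")
      case True
      then obtain l where "(h \<longlongrightarrow> l) (at_left x)"
        using reg local unfolding regulated_on_def by blast
      then have "eventually (\<lambda>z. dist (h z) l < e) (at_left x)"
        using \<open>e > 0\<close> by (rule tendstoD)
      then obtain c where "c < x" "\<And>z. c < z \<Longrightarrow> z < x \<Longrightarrow> dist (h z) l < e"
        unfolding eventually_at_left_real by (auto simp: eventually_at_left_field)
      then show ?thesis
        using that[of "x - c" l] by (force simp: dist_norm)
    next
      case False
      then show ?thesis
        using that[of 1 0] by simp
    qed
    obtain l2 d2 where 2: "d2 > 0" "\<And>z. z \<le> b \<Longrightarrow> x < z \<Longrightarrow> z < x + d2 \<Longrightarrow> norm (h z - l2) \<le> e"
    proof (cases "x < b")
      case True
      then obtain l where "(h \<longlongrightarrow> l) (at_right x)"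
        using reg local unfolding regulated_on_def by blast
      then have "eventually (\<lambda>z. dist (h z) l < e) (at_right x)"
        using \<open>e > 0\<close> by (rule tendstoD)
      then obtain c where "c > x" "\<And>z. x < z \<Longrightarrow> z < c \<Longrightarrow> dist (h z) l < e"
        by (auto simp: eventually_at_right_field)
      then show ?thesis
        using that[of "c - x" l] by (force simp: dist_norm)
    next
      case False
      then show ?thesis
        using that[of 1 0] by simp
    qed
    let ?s = "\<lambda>z. if z < x then l1 else if z = x then h x else l2"
    have "simple_function borel ?s"
      by (intro simple_function_If simple_function_const) simp_all
    moreover have "norm (h z - ?s z) \<le> e"
      if "z \<in> {a..b} \<inter> {p..q}" "p \<le> x" "x \<le> q" "q - p < min d1 d2" for p q z
      using that 1(2)[of z] 2(2)[of z] \<open>e > 0\<close> by auto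
    ultimately have "P p q" if "p \<le> x" "x \<le> q" "q - p < min d1 d2" for p q
      unfolding P_def using that by blast
    then show ?case
      using 1(1) 2(1) by (intro exI[of _ "min d1 d2"]) auto
  qed
  then show ?thesis
    using that unfolding P_def by auto
qed

lemma regulated_on_bounded:
  fixes h :: "real \<Rightarrow> 'a::real_normed_vector"
  assumes "regulated_on a b h"
  obtains B where "B \<ge> 0" "\<And>z. z \<in> {a..b} \<Longrightarrow> norm (h z) \<le> B"
proof -
  obtain s where s: "simple_function borel s" "\<And>z. z \<in> {a..b} \<Longrightarrow> norm (h z - s z) \<le> 1"
    using regulated_on_step_approximation[OF assms zero_less_one] by blast
  have "finite (range s)"
    using s(1) by (simp add: simple_function_def)
  then have "bounded (range s)"
    by (rule finite_imp_bounded)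
  then obtain C where C: "\<And>z. norm (s z) \<le> C"
    by (auto simp: bounded_iff)
  have "norm (h z) \<le> \<bar>1 + C\<bar>" if "z \<in> {a..b}" for z
    using s(2)[OF that] norm_triangle_sub[of "h z" "s z"] C[of z] by linarith
  then show ?thesis
    using that[of "\<bar>1 + C\<bar>"] by simp
qed

section \<open>Bochner integrals of regulated functions\<close>

lemma simple_function_lebesgue_on:
  fixes s :: "real \<Rightarrow> 'a"
  assumes "simple_function borel s"
  shows "simple_function (lebesgue_on {a..b}) s"
proof -
  have fin: "finite (range s)" and lev: "s -` {y} \<in> sets borel" if "y \<in> range s" for y
    using assms that by (auto simp: simple_function_def)
  have "s -` {y} \<inter> {a..b} \<in> sets (lebesgue_on {a..b})" if "y \<in> range s" for y
    using lev[OF that] by (auto simp: sets_restrict_space Int_commute intro!: image_eqI[of _ _ "s -` {y}"])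
  moreover have "finite (s ` {a..b})"
    using assms finite_subset[of "s ` {a..b}" "range s"] by (auto simp: simple_function_def)
  ultimately show ?thesis
    by (auto simp: simple_function_def)
qed

lemma simple_bochner_integrable_lebesgue_on:
  fixes s :: "real \<Rightarrow> 'a::real_vector"
  assumes "simple_function borel s"
  shows "Bochner_Integration.simple_bochner_integrable (lebesgue_on {a..b}) s"
proof
  show "simple_function (lebesgue_on {a..b}) s"
    by (rule simple_function_lebesgue_on[OF assms])
  have "finite_measure (lebesgue_on {a..b})"
    by (intro finite_measure_lebesgue_on) simp
  then show "emeasure (lebesgue_on {a..b}) {y \<in> space (lebesgue_on {a..b}). s y \<noteq> 0} \<noteq> \<infinity>"
    by (simp add: finite_measure.emeasure_finite)
qed

text \<open>The bridge between the two integrals: on step functions they agree, since both give each level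
set the weight of its Lebesgue measure.\<close>

lemma simple_function_has_integral:
  fixes s :: "real \<Rightarrow> 'a::real_normed_vector"
  assumes "simple_function borel s"
  shows "(s has_integral
    Bochner_Integration.simple_bochner_integral (lebesgue_on {a..b}) s) {a..b}"
proof -
  let ?S = "\<lambda>y. {x \<in> {a..b}. s x = y}"
  have fin: "finite (s ` {a..b})"
    using assms finite_subset[of "s ` {a..b}" "range s"] by (auto simp: simple_function_def)
  have meas: "?S y \<in> lmeasurable" for y
  proof -
    have "s -` {y} \<in> sets borel"
    proof (cases "y \<in> range s")
      case True
      then show ?thesis
        using assms by (auto simp: simple_function_def)
    next
      case False
      then have "s -` {y} = {}"
        by blast
      then show ?thesis
        by simp
    qed
    then have "s -` {y} \<inter> {a..b} \<in> sets lebesgue"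
      by (intro sets.Int) auto
    moreover have "s -` {y} \<inter> {a..b} = ?S y"
      by auto
    ultimately show ?thesis
      by (intro bounded_set_imp_lmeasurable) (auto intro: bounded_subset[of "{a..b}"])
  qed
  have "((\<lambda>x. \<Sum>y\<in>s ` {a..b}. indicator (?S y) x *\<^sub>R y) has_integral
      (\<Sum>y\<in>s ` {a..b}. measure lebesgue (?S y) *\<^sub>R y)) {a..b}"
  proof (intro has_integral_sum fin has_integral_scaleR_left)
    fix y
    have "((\<lambda>x. if x \<in> {a..b} then indicator (?S y) x else 0) has_integral measure lebesgue (?S y)) UNIV"
      using meas[of y] unfolding lmeasurable_iff_has_integral
      by (rule has_integral_eq[rotated]) (auto simp: indicator_def)
    then show "((\<lambda>x. indicator (?S y) x :: real) has_integral measure lebesgue (?S y)) {a..b}"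
      unfolding has_integral_restrict_UNIV by simp
  qed
  moreover have "(\<Sum>y\<in>s ` {a..b}. indicator (?S y) x *\<^sub>R y) = s x" if "x \<in> {a..b}" for x
  proof -
    have "(\<Sum>y\<in>s ` {a..b}. indicator (?S y) x *\<^sub>R y) = (\<Sum>y\<in>s ` {a..b}. if y = s x then y else 0)"
      using that by (intro sum.cong) (auto simp: indicator_def)
    then show ?thesis
      using fin that by simp
  qed
  moreover have "Bochner_Integration.simple_bochner_integral (lebesgue_on {a..b}) s =
      (\<Sum>y\<in>s ` {a..b}. measure lebesgue (?S y) *\<^sub>R y)"
  proof -
    have "measure (lebesgue_on {a..b}) (?S y) = measure lebesgue (?S y)" for y
      by (rule measure_restrict_space) auto
    then show ?thesis
      unfolding simple_bochner_integral_def by simp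
  qed
  ultimately show ?thesis
    using has_integral_eq[of "{a..b}" "\<lambda>x. \<Sum>y\<in>s ` {a..b}. indicator (?S y) x *\<^sub>R y" s]
    by simp
qed

lemma regulated_on_integrable:
  fixes h :: "real \<Rightarrow> 'a::banach"
  assumes "regulated_on a b h"
  shows "h integrable_on {a..b}"
proof -
  have "h integrable_on cbox a b"
  proof (rule integrable_uniform_limit)
    fix e :: real assume "e > 0"
    then obtain s where "simple_function borel s" "\<And>z. z \<in> {a..b} \<Longrightarrow> norm (h z - s z) \<le> e"
      using regulated_on_step_approximation[OF assms] by blast
    then show "\<exists>g. (\<forall>x\<in>cbox a b. norm (h x - g x) \<le> e) \<and> g integrable_on cbox a b"
      using simple_function_has_integral[of s a b]
      by (intro exI[of _ s]) (auto simp: has_integral_integrable)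
  qed
  then show ?thesis
    by simp
qed

text \<open>Uniformly approximating step functions converge for both integrals at once. The Bochner
integral in the definition of weak solutions may thus be replaced by the Henstock-Kurzweil
integral, for which linearity, additivity over intervals and norm bounds hold in every
Banach space.\<close>

lemma has_bochner_integral_banach_regulated:
  fixes h :: "real \<Rightarrow> 'a::banach"
  assumes reg: "regulated_on a b h" and "a \<le> b"
  shows "has_bochner_integral_banach (lebesgue_on {a..b}) h (integral {a..b} h)"
proof -
  let ?M = "lebesgue_on {a..b}"
  have "\<exists>s. simple_function borel s \<and> (\<forall>z\<in>{a..b}. norm (h z - s z) \<le> inverse (real (Suc i)))" for i
  proof -
    have "inverse (real (Suc i)) > 0"
      by simp
    then show ?thesis
      using regulated_on_step_approximation[OF reg] by metis
  qed
  then obtain s where s: "\<And>i. simple_function borel (s i)"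
    and approx: "\<And>i z. z \<in> {a..b} \<Longrightarrow> norm (h z - s i z) \<le> inverse (real (Suc i))"
    by metis
  have inv0: "(\<lambda>i. inverse (real (Suc i)) * C) \<longlonglongrightarrow> 0" for C
    using tendsto_mult_left_zero[OF LIMSEQ_inverse_real_of_nat] by blast
  have "(\<lambda>i. s i z) \<longlonglongrightarrow> h z" if "z \<in> {a..b}" for z
  proof (rule LIM_zero_cancel, rule Lim_null_comparison)
    show "\<forall>\<^sub>F i in sequentially. norm (s i z - h z) \<le> inverse (real (Suc i))"
      using approx[OF that] by (simp add: norm_minus_commute)
  qed (rule LIMSEQ_inverse_real_of_nat)
  then have "AE z in ?M. (\<lambda>i. s i z) \<longlonglongrightarrow> h z"
    by (intro AE_I2) simp
  moreover have "(\<lambda>i. \<integral>\<^sup>+ z. ennreal (norm (h z - s i z)) \<partial>?M) \<longlonglongrightarrow> 0"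
  proof (rule tendsto_sandwich[of "\<lambda>_. 0" _ _ "\<lambda>i. ennreal (inverse (real (Suc i)) * (b - a))"])
    have "(\<integral>\<^sup>+ z. ennreal (norm (h z - s i z)) \<partial>?M) \<le> ennreal (inverse (real (Suc i)) * (b - a))" for i
    proof -
      have "(\<integral>\<^sup>+ z. ennreal (norm (h z - s i z)) \<partial>?M) \<le> (\<integral>\<^sup>+ z. ennreal (inverse (real (Suc i))) \<partial>?M)"
        using approx by (intro nn_integral_mono) (simp add: ennreal_leI)
      also have "\<dots> = ennreal (inverse (real (Suc i)) * (b - a))"
        using \<open>a \<le> b\<close> by (simp add: emeasure_restrict_space ennreal_mult)
      finally show ?thesis .
    qed
    then show "\<forall>\<^sub>F i in sequentially. (\<integral>\<^sup>+ z. ennreal (norm (h z - s i z)) \<partial>?M) \<le>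
        ennreal (inverse (real (Suc i)) * (b - a))"
      by simp
    show "(\<lambda>i. ennreal (inverse (real (Suc i)) * (b - a))) \<longlonglongrightarrow> 0"
      using tendsto_ennrealI[OF inv0] by simp
  qed simp_all
  moreover have "(\<lambda>i. Bochner_Integration.simple_bochner_integral ?M (s i)) \<longlonglongrightarrow> integral {a..b} h"
  proof (rule LIM_zero_cancel, rule Lim_null_comparison)
    have "norm (Bochner_Integration.simple_bochner_integral ?M (s i) - integral {a..b} h)
        \<le> inverse (real (Suc i)) * (b - a)" for i
    proof -
      have "((\<lambda>z. s i z - h z) has_integral
          (Bochner_Integration.simple_bochner_integral ?M (s i) - integral {a..b} h)) (cbox a b)"
        using simple_function_has_integral[OF s] regulated_on_integrable[OF reg]
        by (intro has_integral_diff) (auto simp: has_integral_integral)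
      then have "norm (Bochner_Integration.simple_bochner_integral ?M (s i) - integral {a..b} h)
          \<le> inverse (real (Suc i)) * measure lborel (cbox a b)"
        using approx by (intro has_integral_bound) (auto simp: norm_minus_commute)
      then show ?thesis
        using \<open>a \<le> b\<close> by simp
    qed
    then show "\<forall>\<^sub>F i in sequentially.
        norm (Bochner_Integration.simple_bochner_integral ?M (s i) - integral {a..b} h)
          \<le> inverse (real (Suc i)) * (b - a)"
      by simp
  qed (rule inv0)
  ultimately show ?thesis
    unfolding has_bochner_integral_banach_def
    using simple_bochner_integrable_lebesgue_on[OF s] by blast
qed

text \<open>If two sequences of simple functions approximate \<open>g\<close> in mean, then they approximate each other,
so that their integrals have the same limit.\<close>

lemma has_bochner_integral_banach_unique:
  assumes "has_bochner_integral_banach M g I" "has_bochner_integral_banach M g J"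
  shows "I = J"
proof -
  obtain s where s: "\<And>i::nat. Bochner_Integration.simple_bochner_integrable M (s i)"
    "AE z in M. (\<lambda>i. s i z) \<longlonglongrightarrow> g z"
    "(\<lambda>i. \<integral>\<^sup>+ z. ennreal (norm (g z - s i z)) \<partial>M) \<longlonglongrightarrow> 0"
    "(\<lambda>i. Bochner_Integration.simple_bochner_integral M (s i)) \<longlonglongrightarrow> I"
    using assms(1) unfolding has_bochner_integral_banach_def by blast
  obtain r where r: "\<And>i::nat. Bochner_Integration.simple_bochner_integrable M (r i)"
    "(\<lambda>i. \<integral>\<^sup>+ z. ennreal (norm (g z - r i z)) \<partial>M) \<longlonglongrightarrow> 0"
    "(\<lambda>i. Bochner_Integration.simple_bochner_integral M (r i)) \<longlonglongrightarrow> J"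
    using assms(2) unfolding has_bochner_integral_banach_def by blast
  have meas: "(\<lambda>z. norm (p z - q z)) \<in> borel_measurable M"
    if "Bochner_Integration.simple_bochner_integrable M p"
      "Bochner_Integration.simple_bochner_integrable M q" for p q :: "'a \<Rightarrow> 'b"
    using simple_bochner_integrable_compose2[OF _ that, of "\<lambda>x y. norm (x - y)"]
    by (auto elim: simple_bochner_integrable.cases intro: borel_measurable_simple_function)
  \<comment> \<open>The function \<open>norm (g z - p z)\<close> need not be measurable, and without measurability its upper
    and lower integrals may differ. Almost everywhere it equals the measurable function \<open>m p\<close>.\<close>
  define m where "m p z = lim (\<lambda>j. norm (s j z - p z))" for p z
  have m: "m p \<in> borel_measurable M" if "Bochner_Integration.simple_bochner_integrable M p" for p
    unfolding m_def by (intro borel_measurable_lim_metric meas s that)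
  have m_eq: "AE z in M. m p z = norm (g z - p z)" for p
    using s(2) by eventually_elim (auto simp: m_def intro!: limI tendsto_intros)
  have bound: "ennreal (norm (Bochner_Integration.simple_bochner_integral M (s i) -
      Bochner_Integration.simple_bochner_integral M (r i)))
      \<le> (\<integral>\<^sup>+ z. ennreal (norm (g z - s i z)) \<partial>M) + (\<integral>\<^sup>+ z. ennreal (norm (g z - r i z)) \<partial>M)" for i
  proof -
    have d: "Bochner_Integration.simple_bochner_integrable M (\<lambda>z. s i z - r i z)"
      "Bochner_Integration.simple_bochner_integrable M (\<lambda>z. norm (s i z - r i z))"
      using simple_bochner_integrable_compose2[OF _ s(1) r(1), of "\<lambda>x y. x - y"]
        simple_bochner_integrable_compose2[OF _ s(1) r(1), of "\<lambda>x y. norm (x - y)"] by auto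
    have "norm (Bochner_Integration.simple_bochner_integral M (s i) -
        Bochner_Integration.simple_bochner_integral M (r i))
      \<le> Bochner_Integration.simple_bochner_integral M (\<lambda>z. norm (s i z - r i z))"
      using simple_bochner_integral_norm_bound[OF d(1)]
      by (simp add: simple_bochner_integral_diff[OF s(1) r(1)])
    then have "ennreal (norm (Bochner_Integration.simple_bochner_integral M (s i) -
        Bochner_Integration.simple_bochner_integral M (r i)))
      \<le> (\<integral>\<^sup>+ z. ennreal (norm (s i z - r i z)) \<partial>M)"
      using simple_bochner_integral_eq_nn_integral[OF d(2)] by (metis ennreal_leI norm_ge_zero)
    also have "\<dots> \<le> (\<integral>\<^sup>+ z. ennreal (m (s i) z) + ennreal (m (r i) z) \<partial>M)"
    proof (rule nn_integral_mono_AE)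
      show "AE z in M. ennreal (norm (s i z - r i z)) \<le> ennreal (m (s i) z) + ennreal (m (r i) z)"
        using m_eq[of "s i"] m_eq[of "r i"]
      proof eventually_elim
        case (elim z)
        have "norm (s i z - r i z) \<le> norm (g z - s i z) + norm (g z - r i z)"
          by (metis norm_minus_commute norm_diff_triangle_le order_refl)
        then show ?case
          using elim by (simp flip: ennreal_plus add: ennreal_leI)
      qed
    qed
    also have "\<dots> = (\<integral>\<^sup>+ z. ennreal (m (s i) z) \<partial>M) + (\<integral>\<^sup>+ z. ennreal (m (r i) z) \<partial>M)"
      using m[OF s(1)] m[OF r(1)] by (intro nn_integral_add) auto
    also have "(\<integral>\<^sup>+ z. ennreal (m (s i) z) \<partial>M) = (\<integral>\<^sup>+ z. ennreal (norm (g z - s i z)) \<partial>M)"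
      using m_eq[of "s i"] by (intro nn_integral_cong_AE) auto
    also have "(\<integral>\<^sup>+ z. ennreal (m (r i) z) \<partial>M) = (\<integral>\<^sup>+ z. ennreal (norm (g z - r i z)) \<partial>M)"
      using m_eq[of "r i"] by (intro nn_integral_cong_AE) auto
    finally show ?thesis .
  qed
  have lim1: "(\<lambda>i. ennreal (norm (Bochner_Integration.simple_bochner_integral M (s i) -
      Bochner_Integration.simple_bochner_integral M (r i)))) \<longlonglongrightarrow> ennreal (norm (I - J))"
    by (intro tendsto_ennrealI tendsto_intros s r)
  have lim2: "(\<lambda>i. (\<integral>\<^sup>+ z. ennreal (norm (g z - s i z)) \<partial>M) +
      (\<integral>\<^sup>+ z. ennreal (norm (g z - r i z)) \<partial>M)) \<longlonglongrightarrow> 0 + 0"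
    by (intro tendsto_add s r)
  have "ennreal (norm (I - J)) \<le> 0 + 0"
    by (rule LIMSEQ_le[OF lim1 lim2]) (use bound in blast)
  then show ?thesis
    by simp
qed

section \<open>Uniform boundedness\<close>

text \<open>The Banach-Steinhaus theorem. The closed sets of points where the whole family is bounded by \<open>n\<close>
cover the space, so by Baire's theorem one of them contains a ball; taking differences moves
the bound from this ball to a ball around the origin.\<close>

theorem uniform_boundedness:
  fixes T :: "'i \<Rightarrow> 'a::banach \<Rightarrow>\<^sub>L 'b::real_normed_vector"
  assumes "\<And>\<xi>. bounded (range (\<lambda>i. T i \<xi>))"
  shows "bounded (range T)"
proof -
  define F where "F n = {\<xi>. \<forall>i. norm (T i \<xi>) \<le> real n}" for n :: nat
  have closed_F: "closed (F n)" for n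
    unfolding F_def
    by (intro closed_Collect_all closed_Collect_le continuous_intros)
  have "\<Union>(range F) = UNIV"
  proof -
    have "\<exists>n. \<xi> \<in> F n" for \<xi>
    proof -
      obtain C where C: "\<And>i. norm (T i \<xi>) \<le> C"
        using assms[of \<xi>] by (auto simp: bounded_iff)
      obtain n where "C \<le> real n"
        using real_arch_simple by blast
      then have "\<xi> \<in> F n"
        using C order_trans unfolding F_def by blast
      then show ?thesis ..
    qed
    then show ?thesis
      by auto
  qed
  moreover have "euclidean interior_of \<Union>(range F) = {}"
    if "\<And>n. interior (F n) = {}"
  proof (rule Baire_category_alt)
    show "completely_metrizable_space (euclidean :: 'a topology) \<or>
        locally_compact_space (euclidean :: 'a topology) \<and> regular_space (euclidean :: 'a topology)"
      using completely_metrizable_space_euclidean by blast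
    show "closedin euclidean S \<and> euclidean interior_of S = {}" if "S \<in> range F" for S
      using that closed_F \<open>\<And>n. interior (F n) = {}\<close> by auto
  qed simp
  ultimately obtain n where "interior (F n) \<noteq> {}"
    by force
  then obtain \<xi> e where "e > 0" and ball: "cball \<xi> e \<subseteq> F n"
    by (meson all_not_in_conv mem_interior_cball)
  have "norm (T i) \<le> 2 * real n / e" for i
  proof (rule norm_blinfun_bound)
    fix \<eta> :: 'a
    show "norm (T i \<eta>) \<le> 2 * real n / e * norm \<eta>"
    proof (cases "\<eta> = 0")
      case False
      \<comment> \<open>Rescaling \<open>\<eta>\<close> to norm \<open>e\<close> puts \<open>\<xi> + \<zeta>\<close> into the ball.\<close>
      define \<zeta> where "\<zeta> = (e / norm \<eta>) *\<^sub>R \<eta>"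
      have "norm \<zeta> = e"
        using False \<open>e > 0\<close> by (simp add: \<zeta>_def)
      then have "\<xi> + \<zeta> \<in> F n" "\<xi> \<in> F n"
        using ball \<open>e > 0\<close> by (auto simp: dist_norm intro!: subsetD[OF ball])
      then have "norm (T i (\<xi> + \<zeta>)) \<le> n" "norm (T i \<xi>) \<le> n"
        by (auto simp: F_def)
      then have "norm (T i \<zeta>) \<le> 2 * real n"
        using norm_triangle_ineq4[of "T i (\<xi> + \<zeta>)" "T i \<xi>"] by (simp add: blinfun.add_right)
      then have "e / norm \<eta> * norm (T i \<eta>) \<le> 2 * real n"
        using \<open>e > 0\<close> by (simp add: \<zeta>_def blinfun.scaleR_right)
      then show ?thesis
        using False \<open>e > 0\<close> by (simp add: field_simps)
    qed simp
  qed (use \<open>e > 0\<close> in simp)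
  then show ?thesis
    by (auto simp: bounded_iff)
qed

section \<open>Strong continuity of semigroups\<close>

lemma C0_semigroup_add:
  assumes "C0_semigroup T" "s \<ge> 0" "t \<ge> 0"
  shows "T (s + t) \<xi> = T s (T t \<xi>)"
  using assms unfolding C0_semigroup_def by simp

lemma C0_semigroup_zero:
  assumes "C0_semigroup T"
  shows "T 0 \<xi> = \<xi>"
  using assms unfolding C0_semigroup_def by simp

text \<open>Otherwise the norms would be unbounded along some sequence of times tending to \<open>0\<close>, although every
orbit converges, hence stays bounded, along this sequence.\<close>

lemma C0_semigroup_bounded_near_zero:
  assumes "C0_semigroup T"
  obtains \<delta> M where "\<delta> > 0" "\<And>t. 0 \<le> t \<Longrightarrow> t \<le> \<delta> \<Longrightarrow> norm (T t) \<le> M"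
proof (rule ccontr)
  assume contra: "\<not> thesis"
  have "\<exists>t. 0 \<le> t \<and> t \<le> inverse (real (Suc n)) \<and> real n < norm (T t)" for n
  proof (rule ccontr)
    assume "\<nexists>t. 0 \<le> t \<and> t \<le> inverse (real (Suc n)) \<and> real n < norm (T t)"
    then show False
      using contra that[of "inverse (real (Suc n))" "real n"] by force
  qed
  then obtain t where t: "\<And>n. 0 \<le> t n" "\<And>n. t n \<le> inverse (real (Suc n))"
    and large: "\<And>n. real n < norm (T (t n))"
    by metis
  have t_lim: "t \<longlonglongrightarrow> 0"
    by (rule tendsto_sandwich[of "\<lambda>_. 0" _ _ "\<lambda>n. inverse (real (Suc n))"])
      (use t LIMSEQ_inverse_real_of_nat in auto)
  have "bounded (range (\<lambda>n. T (t n) \<xi>))" for \<xi>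
  proof -
    have "((\<lambda>t. T t \<xi>) \<longlongrightarrow> \<xi>) (at 0 within {0..})"
      using assms by (simp add: C0_semigroup_def at_within_Ici_at_right)
    then have "continuous (at 0 within {0..}) (\<lambda>t. T t \<xi>)"
      by (simp add: continuous_within C0_semigroup_zero[OF assms])
    then have "(\<lambda>n. T (t n) \<xi>) \<longlonglongrightarrow> T 0 \<xi>"
      using t t_lim by (intro continuous_within_tendsto_compose'[of 0 "{0..}" "\<lambda>t. T t \<xi>"]) auto
    then show ?thesis
      by (rule convergent_imp_bounded)
  qed
  then have "bounded (range (\<lambda>n. T (t n)))"
    by (rule uniform_boundedness)
  then obtain C where "\<And>n. norm (T (t n)) \<le> C"
    by (auto simp: bounded_iff)
  moreover obtain n where "C \<le> real n"
    using real_arch_simple by blast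
  ultimately show False
    using large[of n] by (meson not_less order_trans)
qed

lemma C0_semigroup_multiple_bound:
  assumes "C0_semigroup T" and "\<delta> \<ge> 0" and "M \<ge> 1"
    and "\<And>t. 0 \<le> t \<Longrightarrow> t \<le> \<delta> \<Longrightarrow> norm (T t) \<le> M"
    and "0 \<le> t" "t \<le> real n * \<delta>"
  shows "norm (T t) \<le> M ^ n"
  using assms(5,6)
proof (induction n arbitrary: t)
  case 0
  then have "T t = id_blinfun"
    using assms(1) by (simp add: C0_semigroup_def)
  then show ?case
    by (simp add: norm_blinfun_id_le)
next
  case (Suc n)
  show ?case
  proof (cases "t \<le> \<delta>")
    case True
    then have "norm (T t) \<le> M"
      using assms(4) Suc by blast
    also have "M \<le> M ^ Suc n"
      using \<open>M \<ge> 1\<close> by (simp add: one_le_power)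
    finally show ?thesis .
  next
    case False
    then have "T t = T \<delta> o\<^sub>L T (t - \<delta>)"
      using assms(1,2) unfolding C0_semigroup_def by (metis add_diff_cancel_left' diff_ge_0_iff_ge le_add_diff_inverse linear)
    then have "norm (T t) \<le> norm (T \<delta>) * norm (T (t - \<delta>))"
      by (simp add: norm_blinfun_compose)
    also have "\<dots> \<le> M * M ^ n"
      using False Suc assms(2,3) assms(4)[of \<delta>]
      by (intro mult_mono Suc.IH) (auto simp: algebra_simps)
    finally show ?thesis
      by simp
  qed
qed

lemma C0_semigroup_locally_bounded:
  assumes "C0_semigroup T"
  obtains M where "M \<ge> 1" "\<And>t. 0 \<le> t \<Longrightarrow> t \<le> b \<Longrightarrow> norm (T t) \<le> M"
proof -
  obtain \<delta> M where \<delta>: "\<delta> > 0" and M: "\<And>t. 0 \<le> t \<Longrightarrow> t \<le> \<delta> \<Longrightarrow> norm (T t) \<le> M"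
    using C0_semigroup_bounded_near_zero[OF assms] by blast
  obtain n where "b / \<delta> \<le> real n"
    using real_arch_simple by blast
  then have "b \<le> real n * \<delta>"
    using \<delta> by (simp add: field_simps)
  then have "norm (T t) \<le> (max 1 M) ^ n" if "0 \<le> t" "t \<le> b" for t
    using that \<delta> M by (intro C0_semigroup_multiple_bound[OF assms, of \<delta>]) (auto simp: le_max_iff_disj)
  then show ?thesis
    using that[of "(max 1 M) ^ n"] by (simp add: one_le_power)
qed

text \<open>For \<open>r \<le> s\<close> one has \<open>T s \<xi> - T r \<xi> = T r (T (s - r) \<xi> - \<xi>)\<close>. For continuity from the left at
\<open>t\<close> the smaller time \<open>r\<close> varies, which is why the local bound on the operator norms has to come
first.\<close>

lemma C0_semigroup_orbit_continuous:
  assumes T: "C0_semigroup T"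
  shows "continuous_on {0..} (\<lambda>t. T t \<xi>)"
proof
  fix t \<epsilon> :: real
  assume "\<epsilon> > 0" "t \<in> {0..}"
  obtain M where "M \<ge> 1" and M: "\<And>s. 0 \<le> s \<Longrightarrow> s \<le> t + 1 \<Longrightarrow> norm (T s) \<le> M"
    using C0_semigroup_locally_bounded[OF T] by blast
  have "((\<lambda>h. T h \<xi>) \<longlongrightarrow> \<xi>) (at_right 0)"
    using T by (simp add: C0_semigroup_def)
  then have "\<forall>\<^sub>F h in at_right 0. dist (T h \<xi>) \<xi> < \<epsilon> / M"
    using \<open>\<epsilon> > 0\<close> \<open>M \<ge> 1\<close> by (intro tendstoD) auto
  then obtain d where "d > 0" and d: "\<And>h. 0 < h \<Longrightarrow> h < d \<Longrightarrow> dist (T h \<xi>) \<xi> < \<epsilon> / M"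
    by (auto simp: eventually_at_right_field)
  have step: "dist (T s \<xi>) (T r \<xi>) \<le> \<epsilon>" if "0 \<le> r" "r \<le> s" "s - r < d" "r \<le> t + 1" for r s
  proof (cases "r = s")
    case False
    have "T s \<xi> - T r \<xi> = T r (T (s - r) \<xi> - \<xi>)"
      using C0_semigroup_add[OF T, of r "s - r"] that by (simp add: blinfun.diff_right)
    then have "dist (T s \<xi>) (T r \<xi>) \<le> norm (T r) * dist (T (s - r) \<xi>) \<xi>"
      by (simp add: dist_norm norm_blinfun)
    also have "\<dots> \<le> M * (\<epsilon> / M)"
      using M[of r] d[of "s - r"] that False \<open>M \<ge> 1\<close> by (intro mult_mono) auto
    finally show ?thesis
      using \<open>M \<ge> 1\<close> by simp
  qed (use \<open>\<epsilon> > 0\<close> in simp)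
  have "dist (T s \<xi>) (T t \<xi>) \<le> \<epsilon>" if "s \<in> {0..}" "dist s t < min d 1" for s
  proof (cases "s \<le> t")
    case True
    then show ?thesis
      using step[of s t] that by (simp add: dist_commute dist_real_def)
  next
    case False
    then show ?thesis
      using step[of t s] that \<open>t \<in> {0..}\<close> by (simp add: dist_real_def)
  qed
  then show "\<exists>\<delta>>0. \<forall>s\<in>{0..}. dist s t < \<delta> \<longrightarrow> dist (T s \<xi>) (T t \<xi>) \<le> \<epsilon>"
    using \<open>d > 0\<close> by (intro exI[of _ "min d 1"]) auto
qed

text \<open>Joint continuity of \<open>(t, \<xi>) \<mapsto> T t \<xi>\<close>, along an arbitrary filter because it is applied to one-sided
limits of integrands.\<close>

lemma C0_semigroup_tendsto:
  assumes T: "C0_semigroup T" and r: "(r \<longlongrightarrow> t) F" and pos: "\<forall>\<^sub>F z in F. 0 \<le> r z" and "t \<ge> 0"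
    and h: "(h \<longlongrightarrow> \<xi>) F"
  shows "((\<lambda>z. T (r z) (h z)) \<longlongrightarrow> T t \<xi>) F"
proof -
  obtain M where M: "\<And>s. 0 \<le> s \<Longrightarrow> s \<le> t + 1 \<Longrightarrow> norm (T s) \<le> M"
    using C0_semigroup_locally_bounded[OF T] by blast
  have "((\<lambda>z. T (r z) (h z - \<xi>)) \<longlongrightarrow> 0) F"
  proof (rule Lim_null_comparison)
    show "((\<lambda>z. M * norm (h z - \<xi>)) \<longlongrightarrow> 0) F"
      using tendsto_norm_zero[OF LIM_zero[OF h]] by (rule tendsto_mult_right_zero)
    have "\<forall>\<^sub>F z in F. r z < t + 1"
      using order_tendstoD(2)[OF r] by simp
    with pos show "\<forall>\<^sub>F z in F. norm (T (r z) (h z - \<xi>)) \<le> M * norm (h z - \<xi>)"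
    proof eventually_elim
      case (elim z)
      then show ?case
        using M[of "r z"] norm_blinfun[of "T (r z)" "h z - \<xi>"]
        by (meson less_imp_le mult_right_mono norm_ge_zero order_trans)
    qed
  qed
  moreover have "((\<lambda>z. T (r z) \<xi>) \<longlongrightarrow> T t \<xi>) F"
    using pos \<open>t \<ge> 0\<close>
    by (intro continuous_on_tendsto_compose[OF C0_semigroup_orbit_continuous[OF T] r]) auto
  ultimately have "((\<lambda>z. T (r z) (h z - \<xi>) + T (r z) \<xi>) \<longlongrightarrow> 0 + T t \<xi>) F"
    by (rule tendsto_add)
  then show ?thesis
    by (simp add: blinfun.diff_right)
qed

section \<open>Convolution with a semigroup\<close>

lemma regulated_on_convolution_integrand:
  assumes T: "C0_semigroup T" and h: "regulated_on a b h" and "t \<le> b"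
  shows "regulated_on a t (\<lambda>s. T (t - s) (h s))"
  unfolding regulated_on_def
proof safe
  fix s assume "a \<le> s" "s < t"
  then obtain l where "(h \<longlongrightarrow> l) (at_right s)"
    using h \<open>t \<le> b\<close> unfolding regulated_on_def by fastforce
  moreover have "\<forall>\<^sub>F r in at_right s. 0 \<le> t - r"
    using eventually_at_right_less[of s] \<open>s < t\<close>
    by (auto simp: eventually_at_right_field intro!: exI[of _ t])
  ultimately have "((\<lambda>r. T (t - r) (h r)) \<longlongrightarrow> T (t - s) l) (at_right s)"
    using \<open>s < t\<close> by (intro C0_semigroup_tendsto[OF T] tendsto_intros) auto
  then show "\<exists>l. ((\<lambda>s. T (t - s) (h s)) \<longlongrightarrow> l) (at_right s)" ..
next
  fix s assume "a < s" "s \<le> t"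
  then obtain l where "(h \<longlongrightarrow> l) (at_left s)"
    using h \<open>t \<le> b\<close> unfolding regulated_on_def by fastforce
  moreover have "\<forall>\<^sub>F r in at_left s. 0 \<le> t - r"
    using \<open>s \<le> t\<close> by (auto simp: eventually_at_left_field intro!: exI[of _ "s - 1"])
  ultimately have "((\<lambda>r. T (t - r) (h r)) \<longlongrightarrow> T (t - s) l) (at_left s)"
    using \<open>s \<le> t\<close> by (intro C0_semigroup_tendsto[OF T] tendsto_intros) auto
  then show "\<exists>l. ((\<lambda>s. T (t - s) (h s)) \<longlongrightarrow> l) (at_left s)" ..
qed

text \<open>The contribution of the forcing term \<open>h\<close> in the variation of constants formula.\<close>

definition convolution :: "(real \<Rightarrow> 'a::banach \<Rightarrow>\<^sub>L 'a) \<Rightarrow> real \<Rightarrow> (real \<Rightarrow> 'a) \<Rightarrow> real \<Rightarrow> 'a" where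
  "convolution T a h t = integral {a..t} (\<lambda>s. T (t - s) (h s))"

text \<open>By the semigroup law, what the forcing term has achieved up to time \<open>c\<close> evolves freely
afterwards.\<close>

lemma convolution_split:
  assumes T: "C0_semigroup T" and h: "regulated_on a b h" and "a \<le> c" "c \<le> t" "t \<le> b"
  shows "convolution T a h t = T (t - c) (convolution T a h c) + convolution T c h t"
proof -
  have "integral {a..t} (\<lambda>s. T (t - s) (h s)) =
      integral {a..c} (\<lambda>s. T (t - s) (h s)) + integral {c..t} (\<lambda>s. T (t - s) (h s))"
    using assms
    by (intro Henstock_Kurzweil_Integration.integral_combine[symmetric] regulated_on_integrable
        regulated_on_convolution_integrand)
  also have "integral {a..c} (\<lambda>s. T (t - s) (h s)) =
      integral {a..c} (blinfun_apply (T (t - c)) \<circ> (\<lambda>s. T (c - s) (h s)))"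
  proof (rule integral_cong)
    fix s assume "s \<in> {a..c}"
    then show "T (t - s) (h s) = (blinfun_apply (T (t - c)) \<circ> (\<lambda>s. T (c - s) (h s))) s"
      using C0_semigroup_add[OF T, of "t - c" "c - s"] \<open>c \<le> t\<close> by simp
  qed
  also have "\<dots> = T (t - c) (integral {a..c} (\<lambda>s. T (c - s) (h s)))"
    using assms
    by (intro integral_linear regulated_on_integrable regulated_on_convolution_integrand[OF T h]
        blinfun.bounded_linear_right) auto
  finally show ?thesis
    by (simp add: convolution_def)
qed

text \<open>The one estimate from which the continuity, Lipschitz and growth bounds below are obtained, with
different majorants \<open>G\<close>.\<close>

lemma norm_convolution_le:
  assumes T: "C0_semigroup T" and h: "regulated_on a t h" and G: "G integrable_on {a..t}"
    and bound: "\<And>s. s \<in> {a..t} \<Longrightarrow> norm (T (t - s)) * norm (h s) \<le> G s"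
  shows "norm (convolution T a h t) \<le> integral {a..t} G"
  unfolding convolution_def
proof (rule Henstock_Kurzweil_Integration.integral_norm_bound_integral[OF _ G])
  show "(\<lambda>s. T (t - s) (h s)) integrable_on {a..t}"
    by (intro regulated_on_integrable regulated_on_convolution_integrand[OF T h]) simp
  show "norm (T (t - s) (h s)) \<le> G s" if "s \<in> {a..t}" for s
    using norm_blinfun bound[OF that] by (rule order_trans)
qed

lemma convolution_diff:
  assumes T: "C0_semigroup T" and "regulated_on a t g" "regulated_on a t h"
  shows "convolution T a g t - convolution T a h t = convolution T a (\<lambda>s. g s - h s) t"
proof -
  have "(\<lambda>s. T (t - s) (g s)) integrable_on {a..t}" "(\<lambda>s. T (t - s) (h s)) integrable_on {a..t}"
    using assms by (auto intro: regulated_on_integrable regulated_on_convolution_integrand[OF T])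
  then show ?thesis
    unfolding convolution_def
    by (simp add: blinfun.diff_right Henstock_Kurzweil_Integration.integral_diff)
qed

text \<open>The splitting at a time \<open>c\<close> slightly before \<open>t\<close> writes the convolution near \<open>t\<close> as an orbit of the
semigroup, starting at the fixed vector \<open>w\<close>, plus a remainder of size \<open>O(r - c)\<close>. Orbits
are continuous, and the remainder is as small as desired. Fixing \<open>c\<close> first treats both sides of
\<open>t\<close> at once.\<close>

lemma continuous_on_convolution:
  assumes T: "C0_semigroup T" and h: "regulated_on a b h"
  shows "continuous_on {a..b} (convolution T a h)"
proof
  fix t \<epsilon> :: real
  assume "\<epsilon> > 0" and t: "t \<in> {a..b}"
  obtain M where "M \<ge> 1" and M: "\<And>s. 0 \<le> s \<Longrightarrow> s \<le> b - a \<Longrightarrow> norm (T s) \<le> M"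
    using C0_semigroup_locally_bounded[OF T] by blast
  obtain H where "H \<ge> 0" and H: "\<And>s. s \<in> {a..b} \<Longrightarrow> norm (h s) \<le> H"
    using regulated_on_bounded[OF h] by blast
  define N where "N = M * H + 1"
  have "N > 0"
    unfolding N_def using \<open>M \<ge> 1\<close> \<open>H \<ge> 0\<close> by (simp add: add_nonneg_pos)
  \<comment> \<open>The remainders on \<open>{c..r}\<close> and \<open>{c..t}\<close> are at most \<open>2 * N * \<eta>\<close> and \<open>N * \<eta>\<close>, together
    \<open>\<epsilon> / 2\<close>.\<close>
  define \<eta> where "\<eta> = \<epsilon> / (6 * N)"
  have "\<eta> > 0"
    using \<open>N > 0\<close> \<open>\<epsilon> > 0\<close> by (simp add: \<eta>_def)
  define c where "c = max a (t - \<eta>)"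
  have c: "a \<le> c" "c \<le> t" "t - c \<le> \<eta>"
    using t \<open>\<eta> > 0\<close> by (auto simp: c_def)
  define w where "w = convolution T a h c"
  have conv: "norm (convolution T a h r - T (r - c) w) \<le> N * (r - c)" if "c \<le> r" "r \<le> b" for r
  proof -
    have "norm (convolution T c h r) \<le> integral {c..r} (\<lambda>_. M * H)"
    proof (rule norm_convolution_le[OF T])
      show "regulated_on c r h"
        using that c by (intro regulated_on_subinterval[OF h]) auto
      show "norm (T (r - s)) * norm (h s) \<le> M * H" if "s \<in> {c..r}" for s
        using that c \<open>r \<le> b\<close> \<open>M \<ge> 1\<close> by (intro mult_mono M H) auto
    qed auto
    also have "\<dots> = M * H * (r - c)"
      using that by simp
    also have "\<dots> \<le> N * (r - c)"
      using that by (simp add: N_def algebra_simps)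
    finally show ?thesis
      using convolution_split[OF T h \<open>a \<le> c\<close> that] by (simp add: w_def)
  qed
  have "\<exists>d>0. \<forall>r\<in>{0..}. dist r (t - c) < d \<longrightarrow> dist (T r w) (T (t - c) w) < \<epsilon> / 2"
    using C0_semigroup_orbit_continuous[OF T, of w] c half_gt_zero[OF \<open>\<epsilon> > 0\<close>]
    unfolding continuous_on_iff by (metis atLeast_iff diff_ge_0_iff_ge)
  then obtain d where "d > 0"
    and d: "\<And>r. 0 \<le> r \<Longrightarrow> dist r (t - c) < d \<Longrightarrow> dist (T r w) (T (t - c) w) < \<epsilon> / 2"
    by auto
  \<comment> \<open>Times near \<open>t\<close> have to lie after \<open>c\<close>. If \<open>c = t\<close>, then \<open>t\<close> is the left end point \<open>a\<close> and this
    is automatic.\<close>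
  define \<delta> where "\<delta> = min d (min \<eta> (if c < t then t - c else 1))"
  have "\<delta> > 0"
    using \<open>d > 0\<close> \<open>\<eta> > 0\<close> by (simp add: \<delta>_def)
  moreover have "dist (convolution T a h r) (convolution T a h t) \<le> \<epsilon>"
    if "r \<in> {a..b}" "dist r t < \<delta>" for r
  proof -
    have "c \<le> r"
    proof (cases "c < t")
      case True
      then have "\<bar>r - t\<bar> < t - c"
        using that by (simp add: \<delta>_def dist_real_def)
      then show ?thesis
        by linarith
    next
      case False
      then show ?thesis
        using that t \<open>\<eta> > 0\<close> by (auto simp: c_def max_def split: if_splits)
    qed
    have "dist (T (r - c) w) (T (t - c) w) < \<epsilon> / 2"
      using that \<open>c \<le> r\<close> by (intro d) (auto simp: \<delta>_def dist_real_def)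
    moreover have "norm (convolution T a h r - T (r - c) w) \<le> N * (2 * \<eta>)"
    proof -
      have "r - c \<le> 2 * \<eta>"
        using that c by (auto simp: \<delta>_def dist_real_def)
      then show ?thesis
        using conv[of r] \<open>c \<le> r\<close> that \<open>N > 0\<close> by (auto intro: order_trans mult_left_mono)
    qed
    moreover have "norm (convolution T a h t - T (t - c) w) \<le> N * \<eta>"
      using conv[of t] c t \<open>N > 0\<close> by (auto intro: order_trans mult_left_mono)
    moreover have "N * \<eta> = \<epsilon> / 6"
      using \<open>N > 0\<close> by (simp add: \<eta>_def)
    ultimately show ?thesis
      using norm_triangle_ineq[of "convolution T a h r - T (r - c) w" "T (r - c) w - T (t - c) w"]
        norm_triangle_ineq4[of "convolution T a h r - T (t - c) w" "convolution T a h t - T (t - c) w"]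
      by (simp add: dist_norm)
  qed
  ultimately show "\<exists>\<delta>>0. \<forall>r\<in>{a..b}. dist r t < \<delta> \<longrightarrow>
      dist (convolution T a h r) (convolution T a h t) \<le> \<epsilon>"
    by blast
qed

section \<open>An integral inequality\<close>

lemma integral_mono_interval:
  fixes k :: "real \<Rightarrow> real"
  assumes "k integrable_on {a..b}" "\<And>s. s \<in> {a..b} \<Longrightarrow> k s \<ge> 0" "a \<le> s" "s \<le> t" "t \<le> b"
  shows "integral {a..s} k \<le> integral {a..t} k"
  using assms by (intro integral_subset_le) (auto intro: integrable_on_subinterval)

text \<open>The kernel is only assumed to be integrable, so the right hand side \<open>E\<close> need not be
differentiable and no integrating factor is at hand. Its monotonicity gives
\<open>E t - E s \<le> E t * \<theta>\<close>, where \<open>\<theta>\<close> is the integral of \<open>k\<close> from \<open>s\<close> to \<open>t\<close>. On short intervals \<open>\<theta>\<close> is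
small, and then \<open>1 / (1 - \<theta>) \<le> exp ((1 + \<epsilon>) * \<theta>)\<close>. This bound on \<open>E t / E s\<close> is multiplicative
in the interval, so that bisection extends it to \<open>{a..b}\<close>; finally \<open>\<epsilon>\<close> tends to \<open>0\<close>.\<close>

lemma gronwall:
  fixes k z :: "real \<Rightarrow> real"
  assumes "a \<le> b"
    and k: "k integrable_on {a..b}" and kz: "(\<lambda>s. k s * z s) integrable_on {a..b}"
    and k_pos: "\<And>s. s \<in> {a..b} \<Longrightarrow> k s \<ge> 0" and z_pos: "\<And>s. s \<in> {a..b} \<Longrightarrow> z s \<ge> 0"
    and bound: "\<And>t. t \<in> {a..b} \<Longrightarrow> z t \<le> C + integral {a..t} (\<lambda>s. k s * z s)"
  shows "z b \<le> C * exp (integral {a..b} k)"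
proof -
  define E where "E t = C + integral {a..t} (\<lambda>s. k s * z s)" for t
  define \<kappa> where "\<kappa> t = integral {a..t} k" for t
  have "continuous_on {a..b} \<kappa>"
    unfolding \<kappa>_def by (rule indefinite_integral_continuous_1[OF k])
  have E_mono: "E s \<le> E t" if "a \<le> s" "s \<le> t" "t \<le> b" for s t
    unfolding E_def using that k_pos z_pos kz by (intro add_left_mono integral_mono_interval) auto
  have "E a \<ge> 0"
    using bound[of a] z_pos[of a] \<open>a \<le> b\<close> unfolding E_def by force
  have \<kappa>_mono: "\<kappa> s \<le> \<kappa> t" if "a \<le> s" "s \<le> t" "t \<le> b" for s t
    unfolding \<kappa>_def using that k k_pos by (rule integral_mono_interval[rotated 2])
  have incr: "E t - E s \<le> E t * (\<kappa> t - \<kappa> s)" if st: "a \<le> s" "s \<le> t" "t \<le> b" for s t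
  proof -
    have sub: "k integrable_on {s..t}" "(\<lambda>s. k s * z s) integrable_on {s..t}"
      using k kz st by (auto intro: integrable_on_subinterval)
    have "E t - E s = integral {s..t} (\<lambda>r. k r * z r)"
    proof -
      have "integral {a..s} (\<lambda>r. k r * z r) + integral {s..t} (\<lambda>r. k r * z r) = integral {a..t} (\<lambda>r. k r * z r)"
        using st kz by (intro Henstock_Kurzweil_Integration.integral_combine) (auto intro: integrable_on_subinterval)
      then show ?thesis
        by (simp add: E_def)
    qed
    also have "\<dots> \<le> integral {s..t} (\<lambda>r. E t * k r)"
    proof (rule integral_le[OF sub(2)])
      show "(\<lambda>r. E t * k r) integrable_on {s..t}"
        by (rule integrable_on_mult_right[OF sub(1)])
      fix r assume r: "r \<in> {s..t}"
      have "z r \<le> E r"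
        using bound[of r] r st by (simp add: E_def)
      also have "E r \<le> E t"
        using r st by (intro E_mono) auto
      finally show "k r * z r \<le> E t * k r"
        using k_pos[of r] r st by (metis atLeastAtMost_iff mult.commute mult_left_mono order_trans)
    qed
    also have "\<dots> = E t * (\<kappa> t - \<kappa> s)"
    proof -
      have "integral {a..s} k + integral {s..t} k = integral {a..t} k"
        using st k by (intro Henstock_Kurzweil_Integration.integral_combine) (auto intro: integrable_on_subinterval)
      then show ?thesis
        by (simp add: \<kappa>_def)
    qed
    finally show ?thesis .
  qed
  have almost: "E b \<le> E a * exp ((1 + \<epsilon>) * \<kappa> b)" if "\<epsilon> > 0" for \<epsilon>
  proof -
    define P where "P s t \<longleftrightarrow> a \<le> s \<and> t \<le> b \<longrightarrow> E t \<le> E s * exp ((1 + \<epsilon>) * (\<kappa> t - \<kappa> s))" for s t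
    have "P a b"
      using \<open>a \<le> b\<close>
    proof (induction rule: Bolzano)
      case (trans p q r)
      show ?case
        unfolding P_def
      proof
        assume "a \<le> p \<and> r \<le> b"
        then have "E r \<le> E q * exp ((1 + \<epsilon>) * (\<kappa> r - \<kappa> q))" "E q \<le> E p * exp ((1 + \<epsilon>) * (\<kappa> q - \<kappa> p))"
          using trans unfolding P_def by auto
        then have "E r \<le> E p * exp ((1 + \<epsilon>) * (\<kappa> q - \<kappa> p)) * exp ((1 + \<epsilon>) * (\<kappa> r - \<kappa> q))"
          by (meson exp_ge_zero mult_right_mono order_trans)
        then show "E r \<le> E p * exp ((1 + \<epsilon>) * (\<kappa> r - \<kappa> p))"
          by (simp add: mult.assoc algebra_simps flip: exp_add)
      qed
    next
      case (local x)
      \<comment> \<open>For \<open>\<theta> < \<delta>\<close> one has \<open>(1 + \<epsilon>) * (1 - \<theta>) \<ge> 1\<close>, which is what the exponential bound needs.\<close>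
      define \<delta> where "\<delta> = \<epsilon> / (1 + \<epsilon>)"
      have \<delta>: "0 < \<delta>" "\<delta> < 1" "(1 + \<epsilon>) * (1 - \<delta>) = 1"
        using \<open>\<epsilon> > 0\<close> by (auto simp: \<delta>_def field_simps)
      obtain d where "d > 0" and d: "\<And>s. s \<in> {a..b} \<Longrightarrow> dist s x < d \<Longrightarrow> dist (\<kappa> s) (\<kappa> x) < \<delta> / 2"
        using \<open>continuous_on {a..b} \<kappa>\<close> local half_gt_zero[OF \<delta>(1)] unfolding continuous_on_iff
        by (metis atLeastAtMost_iff)
      have "P s t" if "s \<le> x" "x \<le> t" "t - s < d" for s t
        unfolding P_def
      proof
        assume "a \<le> s \<and> t \<le> b"
        then have st: "a \<le> s" "s \<le> t" "t \<le> b"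
          using that by auto
        define \<theta> where "\<theta> = \<kappa> t - \<kappa> s"
        have "dist (\<kappa> s) (\<kappa> x) < \<delta> / 2" "dist (\<kappa> t) (\<kappa> x) < \<delta> / 2"
          using st that by (intro d; simp add: dist_real_def)+
        then have \<theta>: "0 \<le> \<theta>" "\<theta> < \<delta>"
          using \<kappa>_mono[OF st] unfolding \<theta>_def dist_real_def by linarith+
        have "1 \<le> (1 - \<theta>) * (1 + (1 + \<epsilon>) * \<theta>)"
        proof -
          have "(1 + \<epsilon>) * (1 - \<theta>) \<ge> 1"
            using \<theta> \<delta>(3) \<open>\<epsilon> > 0\<close> by (smt (verit) mult_left_mono)
          then have "\<theta> * ((1 + \<epsilon>) * (1 - \<theta>)) \<ge> \<theta> * 1"
            using \<theta> by (intro mult_left_mono) auto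
          then show ?thesis
            by (simp add: algebra_simps)
        qed
        also have "\<dots> \<le> (1 - \<theta>) * exp ((1 + \<epsilon>) * \<theta>)"
          using \<theta> \<delta> by (intro mult_left_mono exp_ge_add_one_self) auto
        finally have exp_bound: "1 \<le> (1 - \<theta>) * exp ((1 + \<epsilon>) * \<theta>)" .
        have "E t \<ge> 0"
          using E_mono[of a t] \<open>E a \<ge> 0\<close> st by simp
        then have "E t * 1 \<le> E t * ((1 - \<theta>) * exp ((1 + \<epsilon>) * \<theta>))"
          using exp_bound by (rule mult_left_mono[rotated])
        also have "\<dots> = (E t * (1 - \<theta>)) * exp ((1 + \<epsilon>) * \<theta>)"
          by simp
        also have "\<dots> \<le> E s * exp ((1 + \<epsilon>) * \<theta>)"
          using incr[OF st] by (intro mult_right_mono) (auto simp: \<theta>_def algebra_simps)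
        finally show "E t \<le> E s * exp ((1 + \<epsilon>) * (\<kappa> t - \<kappa> s))"
          by (simp add: \<theta>_def)
      qed
      then show ?case
        using \<open>d > 0\<close> by blast
    qed
    then show ?thesis
      by (simp add: P_def \<kappa>_def)
  qed
  have "E b \<le> E a * exp (1 * \<kappa> b)"
  proof (rule tendsto_lowerbound)
    show "((\<lambda>\<epsilon>. E a * exp ((1 + \<epsilon>) * \<kappa> b)) \<longlongrightarrow> E a * exp (1 * \<kappa> b)) (at_right 0)"
      by (rule tendsto_eq_intros refl)+ simp
    show "\<forall>\<^sub>F \<epsilon> in at_right 0. E b \<le> E a * exp ((1 + \<epsilon>) * \<kappa> b)"
      using almost by (auto simp: eventually_at_right_field intro!: exI[of _ 1])
  qed simp
  moreover have "z b \<le> E b" "E a = C"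
    using bound[of b] \<open>a \<le> b\<close> by (auto simp: E_def)
  ultimately show ?thesis
    by (simp add: \<kappa>_def)
qed

section \<open>Fixed points of Volterra operators\<close>

lemma integral_exp_le:
  fixes \<nu> :: real
  assumes "\<nu> > 0" "a \<le> t"
  shows "integral {a..t} (\<lambda>s. exp (\<nu> * (s - a))) \<le> exp (\<nu> * (t - a)) / \<nu>"
proof -
  have "((\<lambda>s. exp (\<nu> * (s - a))) has_integral
      exp (\<nu> * (t - a)) / \<nu> - exp (\<nu> * (a - a)) / \<nu>) {a..t}"
    using assms
    by (intro fundamental_theorem_of_calculus)
      (auto intro!: derivative_eq_intros simp flip: has_real_derivative_iff_has_vector_derivative)
  then show ?thesis
    using assms by (simp add: integral_unique)
qed

text \<open>The closed set of functions on which the fixed point argument takes place. The bound \<open>w\<close> makes a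
Lipschitz condition that holds on bounded sets only applicable to all of its elements.\<close>

definition continuous_bounded_by :: "real \<Rightarrow> real \<Rightarrow> (real \<Rightarrow> real) \<Rightarrow> (real \<Rightarrow> 'a::real_normed_vector) \<Rightarrow> bool" where
  "continuous_bounded_by a b w x \<longleftrightarrow> continuous_on {a..b} x \<and> (\<forall>t\<in>{a..b}. norm (x t) \<le> w t)"

text \<open>In the norm weighted by \<open>exp (- \<nu> * (t - a))\<close> an operator of Volterra type is a contraction once
\<open>\<nu>\<close> exceeds the Lipschitz constant sufficiently, whatever the length of the interval. Hence no
continuation of local solutions is needed. The weight is put into the functions: Banach's
theorem is applied to \<open>y t = exp (- \<nu> * (t - a)) * x t\<close> in the space of bounded continuous
functions.\<close>

lemma volterra_fixed_point:
  fixes \<Phi> :: "(real \<Rightarrow> 'a::banach) \<Rightarrow> real \<Rightarrow> 'a"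
  assumes "a \<le> b" "C \<ge> 0"
    and w: "\<And>t. t \<in> {a..b} \<Longrightarrow> w t \<ge> 0"
    and invariant: "\<And>x. continuous_bounded_by a b w x \<Longrightarrow> continuous_bounded_by a b w (\<Phi> x)"
    and lipschitz: "\<And>x y t. continuous_bounded_by a b w x \<Longrightarrow> continuous_bounded_by a b w y \<Longrightarrow>
      t \<in> {a..b} \<Longrightarrow> norm (\<Phi> x t - \<Phi> y t) \<le> C * integral {a..t} (\<lambda>s. norm (x s - y s))"
  shows "\<exists>x. continuous_bounded_by a b w x \<and> (\<forall>t\<in>{a..b}. \<Phi> x t = x t)"
proof -
  \<comment> \<open>The contraction factor will be \<open>C / \<nu> \<le> 1 / 2\<close>.\<close>
  define \<nu> where "\<nu> = 2 * C + 1"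
  have "\<nu> > 0"
    using \<open>C \<ge> 0\<close> by (simp add: \<nu>_def)
  define up where "up y t = exp (\<nu> * (t - a)) *\<^sub>R y t" for y :: "real \<Rightarrow> 'a" and t
  define down where "down x t = exp (- (\<nu> * (t - a))) *\<^sub>R x t" for x :: "real \<Rightarrow> 'a" and t
  have up_down: "up (down x) t = x t" for x t
    by (simp add: up_def down_def flip: exp_add)
  define S where "S = {y :: real \<Rightarrow>\<^sub>C 'a. \<forall>t\<in>{a..b}. norm (up y t) \<le> w t}"
  have in_S: "continuous_bounded_by a b w (up y) \<longleftrightarrow> y \<in> S" for y :: "real \<Rightarrow>\<^sub>C 'a"
  proof -
    have "continuous_on {a..b} (up y)"
      unfolding up_def by (intro continuous_intros) auto
    then show ?thesis
      by (simp add: continuous_bounded_by_def S_def)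
  qed
  \<comment> \<open>Bounded continuous functions live on the whole line, so \<open>\<Phi> x\<close> is continued by its values at
    the end points of \<open>{a..b}\<close>.\<close>
  have "\<exists>y :: real \<Rightarrow>\<^sub>C 'a. \<forall>t. y t = down (\<Phi> x) (clamp a b t)"
    if "continuous_bounded_by a b w x" for x
  proof -
    have "continuous_on {a..b} (\<Phi> x)"
      using invariant[OF that] by (simp add: continuous_bounded_by_def)
    then have "continuous_on (cbox a b) (down (\<Phi> x))"
      unfolding down_def by (auto intro!: continuous_intros)
    then show ?thesis
      by (rule continuous_on_cbox_bcontfunE) blast
  qed
  then obtain \<Psi> :: "(real \<Rightarrow> 'a) \<Rightarrow> (real \<Rightarrow>\<^sub>C 'a)" where
    \<Psi>_clamp: "\<And>x t. continuous_bounded_by a b w x \<Longrightarrow> \<Psi> x t = down (\<Phi> x) (clamp a b t)"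
    by metis
  have \<Psi>: "\<Psi> x t = down (\<Phi> x) t" if "continuous_bounded_by a b w x" "t \<in> {a..b}" for x t
    using \<Psi>_clamp[OF that(1)] that(2) clamp_cancel_cbox[of t a b] by simp
  have up_\<Psi>: "up (\<Psi> x) t = \<Phi> x t" if "continuous_bounded_by a b w x" "t \<in> {a..b}" for x t
    using \<Psi>[OF that] up_down[of "\<Phi> x" t] by (simp add: up_def)
  have "\<exists>!y\<in>S. \<Psi> (up (apply_bcontfun y)) = y"
  proof (rule Banach_fix)
    have "S = (\<Inter>t\<in>{a..b}. {y. norm (up (apply_bcontfun y) t) \<le> w t})"
      by (auto simp: S_def)
    moreover have "closed {y. norm (up (apply_bcontfun y) t) \<le> w t}" for t
    proof -
      have "continuous_on UNIV (\<lambda>y :: real \<Rightarrow>\<^sub>C 'a. y t)"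
        unfolding continuous_on_iff by (meson dist_bounded le_less_trans)
      then show ?thesis
        unfolding up_def by (intro closed_Collect_le continuous_intros)
    qed
    ultimately show "complete S"
      by (metis (no_types, lifting) closed_INT complete_eq_closed)
    have "0 \<in> S"
      using w by (simp add: S_def up_def)
    then show "S \<noteq> {}"
      by blast
    show "(\<lambda>y. \<Psi> (up (apply_bcontfun y))) ` S \<subseteq> S"
    proof safe
      fix y assume "y \<in> S"
      then have "continuous_bounded_by a b w (up y)"
        by (simp add: in_S)
      then show "\<Psi> (up y) \<in> S"
        using up_\<Psi> invariant by (simp add: S_def continuous_bounded_by_def)
    qed
    show "dist (\<Psi> (up x)) (\<Psi> (up y)) \<le> 1/2 * dist x y" if xy: "x \<in> S" "y \<in> S" for x y
    proof (rule dist_bound)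
      fix t0
      define t where "t = clamp a b t0"
      have t: "t \<in> {a..b}"
        using \<open>a \<le> b\<close> clamp_in_interval[of a b t0] by (simp add: t_def)
      have mem: "continuous_bounded_by a b w (up x)" "continuous_bounded_by a b w (up y)"
        using xy by (auto simp: in_S)
      have "integral {a..t} (\<lambda>s. norm (up x s - up y s))
          \<le> integral {a..t} (\<lambda>s. dist x y * exp (\<nu> * (s - a)))"
      proof (rule integral_le)
        show "(\<lambda>s. norm (up x s - up y s)) integrable_on {a..t}"
          unfolding up_def by (intro integrable_continuous_interval continuous_intros) auto
        show "(\<lambda>s. dist x y * exp (\<nu> * (s - a))) integrable_on {a..t}"
          by (intro integrable_continuous_interval continuous_intros)
        fix s
        have "norm (up x s - up y s) = exp (\<nu> * (s - a)) * dist (x s) (y s)"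
          by (simp add: up_def dist_norm flip: scaleR_diff_right)
        then show "norm (up x s - up y s) \<le> dist x y * exp (\<nu> * (s - a))"
          using dist_bounded[of x s y] by (simp add: mult.commute mult_right_mono)
      qed
      also have "\<dots> = dist x y * integral {a..t} (\<lambda>s. exp (\<nu> * (s - a)))"
        by simp
      also have "\<dots> \<le> dist x y * (exp (\<nu> * (t - a)) / \<nu>)"
        using t \<open>\<nu> > 0\<close> by (intro mult_left_mono integral_exp_le) auto
      finally have int: "integral {a..t} (\<lambda>s. norm (up x s - up y s))
          \<le> dist x y * (exp (\<nu> * (t - a)) / \<nu>)" .
      have "dist (\<Psi> (up x) t0) (\<Psi> (up y) t0) =
          exp (- (\<nu> * (t - a))) * norm (\<Phi> (up x) t - \<Phi> (up y) t)"
        using \<Psi>_clamp[OF mem(1)] \<Psi>_clamp[OF mem(2)]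
        by (simp add: t_def down_def dist_norm flip: scaleR_diff_right)
      also have "\<dots> \<le> exp (- (\<nu> * (t - a))) * (C * (dist x y * (exp (\<nu> * (t - a)) / \<nu>)))"
        by (intro mult_left_mono order_trans[OF lipschitz[OF mem t]] int \<open>C \<ge> 0\<close>) simp
      also have "\<dots> = (exp (- (\<nu> * (t - a))) * exp (\<nu> * (t - a))) * (C / \<nu> * dist x y)"
        by simp
      also have "exp (- (\<nu> * (t - a))) * exp (\<nu> * (t - a)) = 1"
        by (simp flip: exp_add)
      also have "1 * (C / \<nu> * dist x y) \<le> 1/2 * dist x y"
        unfolding mult_1 using \<open>C \<ge> 0\<close> by (intro mult_right_mono) (auto simp: \<nu>_def field_simps)
      finally show "dist (\<Psi> (up x) t0) (\<Psi> (up y) t0) \<le> 1/2 * dist x y" .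
    qed
  qed simp_all
  then obtain y where "y \<in> S" and fix_y: "\<Psi> (up y) = y"
    by blast
  then have "continuous_bounded_by a b w (up y)"
    by (simp add: in_S)
  moreover have "\<Phi> (up y) t = up y t" if "t \<in> {a..b}" for t
    using up_\<Psi>[OF calculation that] fix_y by simp
  ultimately show ?thesis
    by blast
qed

section \<open>Existence and uniqueness of weak solutions\<close>

lemma admissible_input_regulated:
  assumes u: "admissible_input u" and "a \<ge> 0"
  shows "regulated_on a b u"
  unfolding regulated_on_def
proof safe
  fix s assume s: "a \<le> s" "s < b"
  show "\<exists>l. (u \<longlongrightarrow> l) (at_right s)"
  proof (cases "s \<in> input_discontinuities u")
    case True
    then show ?thesis
      using u by (simp add: admissible_input_def)
  next
    case False
    then have "(u \<longlongrightarrow> u s) (at s within {0..})"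
      using s \<open>a \<ge> 0\<close> by (simp add: input_discontinuities_def continuous_within)
    then have "(u \<longlongrightarrow> u s) (at_right s)"
      by (rule tendsto_within_subset) (use s \<open>a \<ge> 0\<close> in auto)
    then show ?thesis ..
  qed
next
  fix s assume s: "a < s" "s \<le> b"
  show "\<exists>l. (u \<longlongrightarrow> l) (at_left s)"
  proof (cases "s \<in> input_discontinuities u")
    case True
    then show ?thesis
      using u s \<open>a \<ge> 0\<close> by (simp add: admissible_input_def)
  next
    case False
    then have "(u \<longlongrightarrow> u s) (at s within {0..})"
      using s \<open>a \<ge> 0\<close> by (simp add: input_discontinuities_def continuous_within)
    moreover have "at s within {0..} = at s"
      using s \<open>a \<ge> 0\<close> by (intro at_within_interior) simp
    ultimately have "(u \<longlongrightarrow> u s) (at_left s)"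
      by (metis tendsto_within_subset subset_UNIV)
    then show ?thesis ..
  qed
qed

text \<open>To the right of \<open>s\<close> the map \<open>f\<close> is the continuous map \<open>fk k\<close> of the piece with
\<open>\<tau> k \<le> s < \<tau> (Suc k)\<close>; to the left, of the piece with \<open>\<tau> k < s \<le> \<tau> (Suc k)\<close>, which is where
continuity of \<open>fk k\<close> up to the closed right end enters.\<close>

lemma regulated_on_nonlinearity:
  fixes f :: "real \<Rightarrow> 'x::banach \<Rightarrow> 'u::real_normed_vector \<Rightarrow> 'x"
  assumes "SL1 f" and "a \<ge> 0" and x: "continuous_on {a..b} x" and u: "regulated_on a b u"
  shows "regulated_on a b (\<lambda>s. f s (x s) (u s))"
proof -
  obtain \<tau> fk where \<tau>: "\<tau> 0 = 0" "strict_mono \<tau>" "\<not> bdd_above (range \<tau>)"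
    and fk: "\<And>k. continuous_on ({\<tau> k..\<tau> (Suc k)} \<times> UNIV \<times> UNIV) (\<lambda>(t, \<xi>, \<mu>). fk k t \<xi> \<mu>)"
    and f: "\<And>k t \<xi> \<mu>. t \<in> {\<tau> k..<\<tau> (Suc k)} \<Longrightarrow> f t \<xi> \<mu> = fk k t \<xi> \<mu>"
    using \<open>SL1 f\<close> unfolding SL1_def by metis
  have xr: "regulated_on a b x"
    by (rule continuous_on_imp_regulated_on[OF x])
  have unbounded: "\<exists>n. s < \<tau> n" for s
    using \<tau>(3) by (meson bdd_aboveI2 not_le)
  have lim: "\<exists>l. ((\<lambda>s. f s (x s) (u s)) \<longlongrightarrow> l) F"
    if F: "((\<lambda>s. s) \<longlongrightarrow> s) F" and lims: "(x \<longlongrightarrow> \<xi>) F" "(u \<longlongrightarrow> \<mu>) F"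
      and ev: "\<forall>\<^sub>F r in F. r \<in> {\<tau> k..<\<tau> (Suc k)}" and s: "s \<in> {\<tau> k..\<tau> (Suc k)}" for F s \<xi> \<mu> k
  proof -
    have "((\<lambda>r. (\<lambda>(t, \<xi>, \<mu>). fk k t \<xi> \<mu>) (r, x r, u r)) \<longlongrightarrow> (\<lambda>(t, \<xi>, \<mu>). fk k t \<xi> \<mu>) (s, \<xi>, \<mu>)) F"
      using s ev by (intro continuous_on_tendsto_compose[OF fk] tendsto_Pair F lims)
        (auto elim: eventually_mono)
    then have "((\<lambda>r. fk k r (x r) (u r)) \<longlongrightarrow> fk k s \<xi> \<mu>) F"
      by simp
    moreover have "\<forall>\<^sub>F r in F. fk k r (x r) (u r) = f r (x r) (u r)"
      using ev by eventually_elim (simp add: f)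
    ultimately show ?thesis
      by (blast intro: Lim_transform_eventually)
  qed
  show ?thesis
    unfolding regulated_on_def
  proof safe
    fix s assume s: "a \<le> s" "s < b"
    obtain \<xi> \<mu> where lims: "(x \<longlongrightarrow> \<xi>) (at_right s)" "(u \<longlongrightarrow> \<mu>) (at_right s)"
      using xr u s unfolding regulated_on_def by blast
    define n where "n = (LEAST n. s < \<tau> n)"
    have n: "s < \<tau> n" "\<And>m. m < n \<Longrightarrow> \<tau> m \<le> s"
      unfolding n_def by (rule LeastI_ex[OF unbounded]) (use not_less_Least not_less in blast)
    then obtain k where k: "n = Suc k"
      using \<tau>(1) s \<open>a \<ge> 0\<close> by (cases n) auto
    then have "\<tau> k \<le> s" "s < \<tau> (Suc k)"
      using n(1) n(2)[of k] by auto
    then show "\<exists>l. ((\<lambda>s. f s (x s) (u s)) \<longlongrightarrow> l) (at_right s)"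
      using eventually_at_right_real[OF \<open>s < \<tau> (Suc k)\<close>]
      by (intro lim[OF tendsto_ident_at lims, of k]) (auto elim!: eventually_mono)
  next
    fix s assume s: "a < s" "s \<le> b"
    obtain \<xi> \<mu> where lims: "(x \<longlongrightarrow> \<xi>) (at_left s)" "(u \<longlongrightarrow> \<mu>) (at_left s)"
      using xr u s unfolding regulated_on_def by blast
    define n where "n = (LEAST n. s \<le> \<tau> n)"
    have "\<exists>n. s \<le> \<tau> n"
      using unbounded less_imp_le by blast
    then have n: "s \<le> \<tau> n" "\<And>m. m < n \<Longrightarrow> \<tau> m < s"
      unfolding n_def by (rule LeastI_ex) (use not_less_Least not_le in blast)
    then obtain k where k: "n = Suc k"
      using \<tau>(1) s \<open>a \<ge> 0\<close> by (cases n) auto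
    then have "\<tau> k < s" "s \<le> \<tau> (Suc k)"
      using n(1) n(2)[of k] by auto
    then show "\<exists>l. ((\<lambda>s. f s (x s) (u s)) \<longlongrightarrow> l) (at_left s)"
      using eventually_at_left_real[OF \<open>\<tau> k < s\<close>]
      by (intro lim[OF tendsto_ident_at lims, of k]) (auto elim!: eventually_mono)
  qed
qed

lemma half_open_interval_infinity: "half_open_interval t0 \<infinity> = {t0..}"
  by (auto simp: half_open_interval_def)

lemma solution_interval_initial_segment:
  assumes "solution_interval t0 J" "t \<in> J"
  shows "{t0..t} \<subseteq> J" "t0 \<le> t"
proof -
  have "{t0..t} \<subseteq> J \<and> t0 \<le> t"
  proof -
    consider \<tau> where "J = half_open_interval t0 \<tau>" | \<tau> where "J = {t0..\<tau>}"
      using assms(1) unfolding solution_interval_def by blast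
    then show ?thesis
    proof cases
      case (1 \<tau>)
      then have "t0 \<le> t" "ereal t < \<tau>"
        using assms(2) by (auto simp: half_open_interval_def)
      then have "ereal r < \<tau>" if "r \<le> t" for r
        using that by (meson ereal_less_eq(3) le_less_trans)
      then show ?thesis
        using 1 \<open>t0 \<le> t\<close> by (auto simp: half_open_interval_def)
    next
      case (2 \<tau>)
      then show ?thesis
        using assms(2) by auto
    qed
  qed
  then show "{t0..t} \<subseteq> J" "t0 \<le> t"
    by auto
qed

text \<open>The integrand of the variation of constants formula has one-sided limits for every continuous
candidate \<open>x\<close>, so the Bochner integral exists and is unique.\<close>

lemma weak_solution_iff_convolution:
  assumes T: "C0_semigroup T" and f: "SL1 f" and t0: "t0 \<ge> 0" and u: "admissible_input u"
  shows "weak_solution T f t0 x0 u J x \<longleftrightarrow>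
    solution_interval t0 J \<and> continuous_on J x \<and>
    (\<forall>t\<in>J. x t = T (t - t0) x0 + convolution T t0 (\<lambda>s. f s (x s) (u s)) t)"
proof -
  have "(\<exists>I. has_bochner_integral_banach (lebesgue_on {t0..t}) (\<lambda>s. T (t - s) (f s (x s) (u s))) I \<and>
        x t = T (t - t0) x0 + I) \<longleftrightarrow>
      x t = T (t - t0) x0 + convolution T t0 (\<lambda>s. f s (x s) (u s)) t"
    if "solution_interval t0 J" "continuous_on J x" "t \<in> J" for t
  proof -
    have "continuous_on {t0..t} x"
      using solution_interval_initial_segment[OF that(1,3)] that(2) continuous_on_subset by blast
    then have "regulated_on t0 t (\<lambda>s. f s (x s) (u s))"
      by (rule regulated_on_nonlinearity[OF f t0 _ admissible_input_regulated[OF u t0]])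
    then have "regulated_on t0 t (\<lambda>s. T (t - s) (f s (x s) (u s)))"
      by (intro regulated_on_convolution_integrand[OF T]) auto
    then have "has_bochner_integral_banach (lebesgue_on {t0..t})
        (\<lambda>s. T (t - s) (f s (x s) (u s))) (convolution T t0 (\<lambda>s. f s (x s) (u s)) t)"
      unfolding convolution_def using solution_interval_initial_segment(2)[OF that(1,3)]
      by (rule has_bochner_integral_banach_regulated)
    then show ?thesis
      using has_bochner_integral_banach_unique by blast
  qed
  then show ?thesis
    unfolding weak_solution_def by blast
qed

text \<open>On \<open>{t0..t}\<close> both solutions and the input are bounded, so the local Lipschitz condition holds with
a single constant and Gronwall's lemma applies to the norm of the difference.\<close>

lemma weak_solution_unique:
  fixes f :: "real \<Rightarrow> 'x::banach \<Rightarrow> 'u::real_normed_vector \<Rightarrow> 'x"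
  assumes T: "C0_semigroup T" and f: "SL1 f" "SL2 f" and t0: "t0 \<ge> 0" and u: "admissible_input u"
    and x: "weak_solution T f t0 x0 u J x" and y: "weak_solution T f t0 x0 u J' y"
    and t: "t \<in> J" "t \<in> J'"
  shows "x t = y t"
proof -
  note conv = weak_solution_iff_convolution[OF T f(1) t0 u]
  have J: "solution_interval t0 J" "solution_interval t0 J'"
    using x y by (auto simp: weak_solution_def)
  have sub: "{t0..t} \<subseteq> J" "{t0..t} \<subseteq> J'" "t0 \<le> t"
    using solution_interval_initial_segment J t by blast+
  have cont: "continuous_on {t0..t} x" "continuous_on {t0..t} y"
    using x y sub continuous_on_subset unfolding weak_solution_def by blast+
  have reg_u: "regulated_on t0 t u"
    by (rule admissible_input_regulated[OF u t0])
  obtain M where "M \<ge> 1" and M: "\<And>s. 0 \<le> s \<Longrightarrow> s \<le> t - t0 \<Longrightarrow> norm (T s) \<le> M"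
    using C0_semigroup_locally_bounded[OF T] by blast
  obtain Bx where "Bx \<ge> 0" and Bx: "\<And>s. s \<in> {t0..t} \<Longrightarrow> norm (x s) \<le> Bx"
    by (rule regulated_on_bounded[OF continuous_on_imp_regulated_on[OF cont(1)]]) blast
  obtain By where "By \<ge> 0" and By: "\<And>s. s \<in> {t0..t} \<Longrightarrow> norm (y s) \<le> By"
    by (rule regulated_on_bounded[OF continuous_on_imp_regulated_on[OF cont(2)]]) blast
  obtain Bu where "Bu \<ge> 0" and Bu: "\<And>s. s \<in> {t0..t} \<Longrightarrow> norm (u s) \<le> Bu"
    by (rule regulated_on_bounded[OF reg_u]) blast
  define r where "r = max 1 (max Bx (max By Bu))"
  have "r > 0"
    by (simp add: r_def)
  then obtain L where "L \<ge> 0" and L: "\<And>s \<xi> \<omega> \<mu>. 0 \<le> s \<Longrightarrow> norm \<xi> \<le> r \<Longrightarrow> norm \<omega> \<le> r \<Longrightarrow> norm \<mu> \<le> r \<Longrightarrow>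
      norm (f s \<xi> \<mu> - f s \<omega> \<mu>) \<le> L * norm (\<xi> - \<omega>)"
    using f(2) unfolding SL2_def by meson
  define z where "z s = norm (x s - y s)" for s
  have z_cont: "continuous_on {t0..t} z"
    unfolding z_def by (intro continuous_intros cont)
  have "z t \<le> 0 * exp (integral {t0..t} (\<lambda>_. M * L))"
  proof (rule gronwall[OF \<open>t0 \<le> t\<close>])
    show "(\<lambda>s. M * L * z s) integrable_on {t0..t}"
      by (intro integrable_continuous_interval continuous_intros z_cont)
    show "z s \<le> 0 + integral {t0..s} (\<lambda>s. M * L * z s)" if s: "s \<in> {t0..t}" for s
    proof -
      have reg: "regulated_on t0 s (\<lambda>s. f s (x s) (u s))" "regulated_on t0 s (\<lambda>s. f s (y s) (u s))"
        using s
        by (auto intro!: regulated_on_nonlinearity[OF f(1) t0 _ admissible_input_regulated[OF u t0]]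
            continuous_on_subset[OF cont(1)] continuous_on_subset[OF cont(2)])
      have "x s - y s = convolution T t0 (\<lambda>s. f s (x s) (u s)) s - convolution T t0 (\<lambda>s. f s (y s) (u s)) s"
        using x y s sub unfolding conv by (simp add: subset_iff)
      also have "\<dots> = convolution T t0 (\<lambda>s. f s (x s) (u s) - f s (y s) (u s)) s"
        by (rule convolution_diff[OF T reg])
      finally have "z s = norm (convolution T t0 (\<lambda>s. f s (x s) (u s) - f s (y s) (u s)) s)"
        by (simp add: z_def)
      also have "\<dots> \<le> integral {t0..s} (\<lambda>s. M * L * z s)"
      proof (rule norm_convolution_le[OF T regulated_on_diff[OF reg]])
        show "(\<lambda>s. M * L * z s) integrable_on {t0..s}"
          using s by (intro integrable_continuous_interval continuous_intros continuous_on_subset[OF z_cont]) auto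
        fix q assume q: "q \<in> {t0..s}"
        then have "norm (x q) \<le> r" "norm (y q) \<le> r" "norm (u q) \<le> r"
          using Bx[of q] By[of q] Bu[of q] s by (auto simp: r_def le_max_iff_disj)
        then have "norm (f q (x q) (u q) - f q (y q) (u q)) \<le> L * z q"
          unfolding z_def using q t0 by (intro L) auto
        moreover have "norm (T (s - q)) \<le> M"
          using q s by (intro M) auto
        ultimately show "norm (T (s - q)) * norm (f q (x q) (u q) - f q (y q) (u q)) \<le> M * L * z q"
          using \<open>M \<ge> 1\<close> by (metis mult.assoc mult_mono norm_ge_zero order_trans zero_le_one)
      qed
      finally show ?thesis
        by simp
    qed
  qed (use \<open>M \<ge> 1\<close> \<open>L \<ge> 0\<close> in \<open>auto simp: z_def\<close>)
  then show ?thesis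
    by (simp add: z_def)
qed

text \<open>Linear growth of \<open>f\<close> makes the functions bounded by \<open>R * exp (\<nu> * (t - t0))\<close> invariant under the
variation of constants operator, for suitable \<open>R\<close> and \<open>\<nu>\<close>. These functions share a bound on
\<open>{t0..b}\<close>, whence the operator has a Lipschitz constant on them and a fixed point on the whole
interval.\<close>

lemma weak_solution_exists_compact:
  fixes f :: "real \<Rightarrow> 'x::banach \<Rightarrow> 'u::real_normed_vector \<Rightarrow> 'x"
  assumes T: "C0_semigroup T" and f: "SL1 f" "SL2 f" and t0: "t0 \<ge> 0" and u: "admissible_input u"
    and growth: "\<And>B. \<exists>c\<ge>0. \<forall>t\<ge>0. \<forall>\<xi> \<mu>. norm \<mu> \<le> B \<longrightarrow> norm (f t \<xi> \<mu>) \<le> c * (norm \<xi> + 1)"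
    and "t0 < b"
  obtains x where "weak_solution T f t0 x0 u {t0..b} x"
proof -
  have reg_u: "regulated_on t0 b u"
    by (rule admissible_input_regulated[OF u t0])
  obtain M where "M \<ge> 1" and M: "\<And>s. 0 \<le> s \<Longrightarrow> s \<le> b - t0 \<Longrightarrow> norm (T s) \<le> M"
    using C0_semigroup_locally_bounded[OF T] by blast
  obtain B where "B \<ge> 0" and B: "\<And>s. s \<in> {t0..b} \<Longrightarrow> norm (u s) \<le> B"
    by (rule regulated_on_bounded[OF reg_u]) blast
  obtain c where "c \<ge> 0" and c: "\<And>t \<xi> \<mu>. 0 \<le> t \<Longrightarrow> norm \<mu> \<le> B \<Longrightarrow> norm (f t \<xi> \<mu>) \<le> c * (norm \<xi> + 1)"
    using growth[of B] by meson
  \<comment> \<open>With this \<open>\<nu>\<close> the integral of the linear part takes up at most half of \<open>w\<close>; with the \<open>R\<close> below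
    the initial value and the constant part take up at most the other half.\<close>
  define \<nu> where "\<nu> = 2 * (M * c) + 1"
  have Mc: "M * c \<ge> 0"
    using \<open>M \<ge> 1\<close> \<open>c \<ge> 0\<close> by simp
  then have "\<nu> > 0"
    by (simp add: \<nu>_def)
  define R where "R = 2 * (M * norm x0 + M * c * (b - t0))"
  have "R \<ge> 0"
    using Mc \<open>M \<ge> 1\<close> \<open>t0 < b\<close> by (simp add: R_def)
  define w where "w t = R * exp (\<nu> * (t - t0))" for t
  define \<Phi> where "\<Phi> x t = T (t - t0) x0 + convolution T t0 (\<lambda>s. f s (x s) (u s)) t" for x t
  define r where "r = max 1 (max (w b) B)"
  have "r > 0"
    by (simp add: r_def)
  then obtain L where "L \<ge> 0" and L: "\<And>s \<xi> \<omega> \<mu>. 0 \<le> s \<Longrightarrow> norm \<xi> \<le> r \<Longrightarrow> norm \<omega> \<le> r \<Longrightarrow> norm \<mu> \<le> r \<Longrightarrow>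
      norm (f s \<xi> \<mu> - f s \<omega> \<mu>) \<le> L * norm (\<xi> - \<omega>)"
    using f(2) unfolding SL2_def by meson
  have reg: "regulated_on t0 t (\<lambda>s. f s (x s) (u s))" if "continuous_on {t0..b} x" "t \<le> b" for x t
    using that(2)
    by (auto intro!: regulated_on_nonlinearity[OF f(1) t0 _ admissible_input_regulated[OF u t0]]
        continuous_on_subset[OF that(1)])
  have "continuous_bounded_by t0 b w (\<Phi> x)" if x: "continuous_bounded_by t0 b w x" for x
  proof -
    have x_cont: "continuous_on {t0..b} x" and x_bound: "\<And>s. s \<in> {t0..b} \<Longrightarrow> norm (x s) \<le> w s"
      using x by (auto simp: continuous_bounded_by_def)
    have "continuous_on {t0..b} (\<lambda>t. T (t - t0) x0)"
      by (intro continuous_on_compose2[OF C0_semigroup_orbit_continuous[OF T]] continuous_intros) auto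
    then have "continuous_on {t0..b} (\<Phi> x)"
      unfolding \<Phi>_def by (intro continuous_on_add continuous_on_convolution[OF T reg[OF x_cont order_refl]])
    moreover have "norm (\<Phi> x t) \<le> w t" if t: "t \<in> {t0..b}" for t
    proof -
      have exp_int: "(\<lambda>s. exp (\<nu> * (s - t0))) integrable_on {t0..t}"
        by (intro integrable_continuous_interval continuous_intros)
      have "norm (convolution T t0 (\<lambda>s. f s (x s) (u s)) t)
          \<le> integral {t0..t} (\<lambda>s. M * c * R * exp (\<nu> * (s - t0)) + M * c)"
      proof (rule norm_convolution_le[OF T reg[OF x_cont]])
        show "(\<lambda>s. M * c * R * exp (\<nu> * (s - t0)) + M * c) integrable_on {t0..t}"
          by (intro integrable_continuous_interval continuous_intros)
        fix s assume s: "s \<in> {t0..t}"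
        have "norm (f s (x s) (u s)) \<le> c * (norm (x s) + 1)"
          using s t t0 B[of s] by (intro c) auto
        also have "\<dots> \<le> c * (w s + 1)"
          using s t x_bound[of s] \<open>c \<ge> 0\<close> by (intro mult_left_mono) auto
        finally have "norm (T (t - s)) * norm (f s (x s) (u s)) \<le> M * (c * (w s + 1))"
          using s t \<open>M \<ge> 1\<close> by (intro mult_mono M) auto
        then show "norm (T (t - s)) * norm (f s (x s) (u s)) \<le> M * c * R * exp (\<nu> * (s - t0)) + M * c"
          by (simp add: w_def algebra_simps)
      qed (use t in simp)
      also have "\<dots> = M * c * R * integral {t0..t} (\<lambda>s. exp (\<nu> * (s - t0))) + M * c * (t - t0)"
        using t exp_int by (subst Henstock_Kurzweil_Integration.integral_add) (auto intro!: integrable_on_mult_right)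
      also have "\<dots> \<le> M * c * R * (exp (\<nu> * (t - t0)) / \<nu>) + M * c * (b - t0)"
        using t Mc \<open>R \<ge> 0\<close> \<open>\<nu> > 0\<close> by (intro add_mono mult_left_mono integral_exp_le) auto
      also have "M * c * R * (exp (\<nu> * (t - t0)) / \<nu>) = M * c / \<nu> * w t"
        by (simp add: w_def)
      also have "\<dots> \<le> 1 / 2 * w t"
        using Mc \<open>R \<ge> 0\<close> by (intro mult_right_mono) (auto simp: w_def \<nu>_def field_simps)
      finally have "norm (convolution T t0 (\<lambda>s. f s (x s) (u s)) t) \<le> w t / 2 + M * c * (b - t0)"
        by simp
      moreover have "norm (T (t - t0) x0) \<le> M * norm x0"
        using t by (intro order_trans[OF norm_blinfun] mult_right_mono M) auto
      moreover have "R * 1 \<le> w t"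
        unfolding w_def using t \<open>R \<ge> 0\<close> \<open>\<nu> > 0\<close> by (intro mult_left_mono) auto
      ultimately show ?thesis
        using norm_triangle_ineq[of "T (t - t0) x0" "convolution T t0 (\<lambda>s. f s (x s) (u s)) t"]
        by (simp add: \<Phi>_def R_def)
    qed
    ultimately show ?thesis
      by (simp add: continuous_bounded_by_def)
  qed
  moreover have "norm (\<Phi> x t - \<Phi> y t) \<le> M * L * integral {t0..t} (\<lambda>s. norm (x s - y s))"
    if x: "continuous_bounded_by t0 b w x" and y: "continuous_bounded_by t0 b w y" and t: "t \<in> {t0..b}" for x y t
  proof -
    have cont: "continuous_on {t0..b} x" "continuous_on {t0..b} y"
      and bound: "\<And>s. s \<in> {t0..b} \<Longrightarrow> norm (x s) \<le> w s" "\<And>s. s \<in> {t0..b} \<Longrightarrow> norm (y s) \<le> w s"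
      using x y by (auto simp: continuous_bounded_by_def)
    have "\<Phi> x t - \<Phi> y t = convolution T t0 (\<lambda>s. f s (x s) (u s) - f s (y s) (u s)) t"
      using t by (simp add: \<Phi>_def convolution_diff[OF T reg[OF cont(1)] reg[OF cont(2)]])
    also have "norm \<dots> \<le> integral {t0..t} (\<lambda>s. M * L * norm (x s - y s))"
    proof (rule norm_convolution_le[OF T])
      show "regulated_on t0 t (\<lambda>s. f s (x s) (u s) - f s (y s) (u s))"
        using t by (intro regulated_on_diff reg cont) auto
      show "(\<lambda>s. M * L * norm (x s - y s)) integrable_on {t0..t}"
        using t by (intro integrable_continuous_interval continuous_intros)
          (auto intro: continuous_on_subset[OF cont(1)] continuous_on_subset[OF cont(2)])
      fix s assume s: "s \<in> {t0..t}"
      have "w s \<le> w b"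
        unfolding w_def using s t \<open>R \<ge> 0\<close> \<open>\<nu> > 0\<close> by (intro mult_left_mono) auto
      then have "norm (x s) \<le> r" "norm (y s) \<le> r" "norm (u s) \<le> r"
        using B[of s] bound[of s] s t by (auto simp: r_def le_max_iff_disj)
      then have "norm (f s (x s) (u s) - f s (y s) (u s)) \<le> L * norm (x s - y s)"
        using s t0 by (intro L) auto
      then have "norm (T (t - s)) * norm (f s (x s) (u s) - f s (y s) (u s)) \<le> M * (L * norm (x s - y s))"
        using s t \<open>M \<ge> 1\<close> by (intro mult_mono M) auto
      then show "norm (T (t - s)) * norm (f s (x s) (u s) - f s (y s) (u s)) \<le> M * L * norm (x s - y s)"
        by (simp add: mult.assoc)
    qed
    finally show ?thesis
      by simp
  qed
  ultimately have "\<exists>x. continuous_bounded_by t0 b w x \<and> (\<forall>t\<in>{t0..b}. \<Phi> x t = x t)"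
    using \<open>t0 < b\<close> \<open>M \<ge> 1\<close> \<open>L \<ge> 0\<close> \<open>R \<ge> 0\<close>
    by (intro volterra_fixed_point[where C = "M * L"]) (auto simp: w_def)
  then obtain x where x: "continuous_bounded_by t0 b w x" "\<And>t. t \<in> {t0..b} \<Longrightarrow> \<Phi> x t = x t"
    by blast
  have "weak_solution T f t0 x0 u {t0..b} x"
    unfolding weak_solution_iff_convolution[OF T f(1) t0 u]
    using x \<open>t0 < b\<close> by (auto simp: continuous_bounded_by_def \<Phi>_def solution_interval_def)
  then show ?thesis
    using that by blast
qed

lemma weak_solution_exists_global:
  fixes f :: "real \<Rightarrow> 'x::banach \<Rightarrow> 'u::real_normed_vector \<Rightarrow> 'x"
  assumes T: "C0_semigroup T" and f: "SL1 f" "SL2 f" and t0: "t0 \<ge> 0" and u: "admissible_input u"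
    and growth: "\<And>B. \<exists>c\<ge>0. \<forall>t\<ge>0. \<forall>\<xi> \<mu>. norm \<mu> \<le> B \<longrightarrow> norm (f t \<xi> \<mu>) \<le> c * (norm \<xi> + 1)"
  obtains x where "weak_solution T f t0 x0 u {t0..} x"
proof -
  have "\<exists>x. weak_solution T f t0 x0 u {t0..b} x" if "t0 < b" for b
    using weak_solution_exists_compact[OF T f t0 u growth that] by blast
  then obtain y where y: "\<And>b. t0 < b \<Longrightarrow> weak_solution T f t0 x0 u {t0..b} (y b)"
    by metis
  \<comment> \<open>By uniqueness any \<open>y b\<close> with \<open>t \<le> b\<close> would do here; \<open>b = t + 1\<close> keeps \<open>t\<close> inside.\<close>
  define x where "x t = y (t + 1) t" for t
  have x_eq: "x s = y b s" if "s \<in> {t0..b}" "t0 < b" for s b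
    unfolding x_def using that
    by (intro weak_solution_unique[OF T f t0 u y y]) auto
  have "continuous_on {t0..b} x" if "t0 < b" for b
    using y[OF that] x_eq[OF _ that] continuous_on_cong[of "{t0..b}" "{t0..b}" x "y b"]
    by (auto simp: weak_solution_def)
  then have "(x \<longlongrightarrow> x t) (at t within {t0..t + 1})" if "t0 \<le> t" for t
    using that unfolding continuous_on_def by simp
  moreover have "at t within {t0..t + 1} = at t within {t0..}" for t
    by (rule at_within_nhd[of t "{..<t + 1}"]) auto
  ultimately have "continuous_on {t0..} x"
    by (simp add: continuous_on_def)
  moreover have "x t = T (t - t0) x0 + convolution T t0 (\<lambda>s. f s (x s) (u s)) t" if "t0 \<le> t" for t
  proof -
    have "t0 < t + 1"
      using that by simp
    have "x t = T (t - t0) x0 + convolution T t0 (\<lambda>s. f s (y (t + 1) s) (u s)) t"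
      using y[OF \<open>t0 < t + 1\<close>] that unfolding weak_solution_iff_convolution[OF T f(1) t0 u] x_def by simp
    also have "convolution T t0 (\<lambda>s. f s (y (t + 1) s) (u s)) t = convolution T t0 (\<lambda>s. f s (x s) (u s)) t"
      unfolding convolution_def by (intro integral_cong) (simp add: x_eq[OF _ \<open>t0 < t + 1\<close>])
    finally show ?thesis .
  qed
  moreover have "solution_interval t0 {t0..}"
    unfolding solution_interval_def
    by (intro disjI1 exI[of _ \<infinity>]) (simp add: half_open_interval_infinity)
  ultimately have "weak_solution T f t0 x0 u {t0..} x"
    unfolding weak_solution_iff_convolution[OF T f(1) t0 u] by simp
  then show ?thesis
    using that by blast
qed

text \<open>A solution on \<open>{t0..}\<close> cannot be prolonged. By uniqueness it prolongs every other solution, which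
therefore is maximal only if it is defined on \<open>{t0..}\<close> as well. So both definite descriptions
have the expected value.\<close>

lemma global_weak_solution_flow:
  fixes f :: "real \<Rightarrow> 'x::banach \<Rightarrow> 'u::real_normed_vector \<Rightarrow> 'x"
  assumes T: "C0_semigroup T" and f: "SL1 f" "SL2 f" and t0: "t0 \<ge> 0" and u: "admissible_input u"
    and X: "weak_solution T f t0 x0 u {t0..} X"
  shows "end_time T f t0 x0 u = \<infinity>" "\<And>t. t0 \<le> t \<Longrightarrow> flow T f t t0 x0 u = X t"
proof -
  have maximal: "maximal_weak_solution T f t0 x0 u \<infinity> X"
    unfolding maximal_weak_solution_def half_open_interval_infinity
  proof (intro conjI allI impI X)
    fix J y
    assume "weak_solution T f t0 x0 u J y \<and> {t0..} \<subseteq> J \<and> (\<forall>t\<in>{t0..}. y t = X t)"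
    then show "J = {t0..}"
      using solution_interval_initial_segment(2) unfolding weak_solution_def by blast
  qed simp
  have unique: "\<tau> = \<infinity> \<and> (\<forall>t\<in>half_open_interval t0 \<tau>. x t = X t)"
    if "maximal_weak_solution T f t0 x0 u \<tau> x" for \<tau> x
  proof -
    have x: "weak_solution T f t0 x0 u (half_open_interval t0 \<tau>) x" and "ereal t0 < \<tau>"
      and ext: "\<And>J y. weak_solution T f t0 x0 u J y \<Longrightarrow> half_open_interval t0 \<tau> \<subseteq> J \<Longrightarrow>
        \<forall>t\<in>half_open_interval t0 \<tau>. y t = x t \<Longrightarrow> J = half_open_interval t0 \<tau>"
      using that by (auto simp: maximal_weak_solution_def)
    have sub: "half_open_interval t0 \<tau> \<subseteq> {t0..}"
      by (auto simp: half_open_interval_def)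
    have eq: "\<forall>t\<in>half_open_interval t0 \<tau>. X t = x t"
      using weak_solution_unique[OF T f t0 u X x] sub by blast
    have "{t0..} = half_open_interval t0 \<tau>"
      by (rule ext[OF X sub eq])
    then have below: "ereal r < \<tau>" if "t0 \<le> r" for r
      using that by (auto simp: half_open_interval_def)
    have "\<tau> = \<infinity>"
    proof (cases \<tau>)
      case (real r)
      then show ?thesis
        using \<open>ereal t0 < \<tau>\<close> below[of r] by simp
    qed (use \<open>ereal t0 < \<tau>\<close> in auto)
    with eq show ?thesis
      by simp
  qed
  show "end_time T f t0 x0 u = \<infinity>"
    unfolding end_time_def using maximal unique by (intro the_equality) blast+
  show "flow T f t t0 x0 u = X t" if "t0 \<le> t" for t
    unfolding flow_def
  proof (rule the_equality)
    show "\<exists>\<tau> x. maximal_weak_solution T f t0 x0 u \<tau> x \<and> t \<in> half_open_interval t0 \<tau> \<and> X t = x t"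
      using maximal that by (intro exI[of _ \<infinity>] exI[of _ X]) (simp add: half_open_interval_infinity)
  qed (use unique in metis)
qed

section \<open>Stability\<close>

lemma class_K_mono:
  assumes "class_K \<alpha>" "0 \<le> r" "r \<le> s"
  shows "\<alpha> r \<le> \<alpha> s"
  using assms strict_mono_on_leD[of "{0..}" \<alpha> r s] by (simp add: class_K_def)

lemma class_K_nonneg:
  assumes "class_K \<alpha>" "0 \<le> r"
  shows "0 \<le> \<alpha> r"
  using class_K_mono[OF assms(1), of 0 r] assms by (simp add: class_K_def)

lemma regulated_on_gain:
  assumes "class_K \<alpha>" "regulated_on a b u"
  shows "regulated_on a b (\<lambda>s. \<alpha> (norm (u s)))"
proof (rule regulated_on_compose_continuous[OF assms(2)])
  show "continuous_on UNIV (\<lambda>\<mu>. \<alpha> (norm \<mu>))"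
    using assms(1) by (intro continuous_on_compose2[of "{0..}" \<alpha> UNIV norm])
      (auto simp: class_K_def intro: continuous_intros)
qed

lemma admissible_input_zero: "admissible_input (\<lambda>_. 0)"
  by (simp add: admissible_input_def input_discontinuities_def)

text \<open>The zero input has norm \<open>0\<close>, so the gain term of the iISS estimate vanishes.\<close>

lemma iISS_imp_zero_GUAS:
  fixes f :: "real \<Rightarrow> 'x::banach \<Rightarrow> 'u::real_normed_vector \<Rightarrow> 'x"
  assumes "iISS T f"
  shows "zero_GUAS T f"
proof -
  obtain \<kappa> \<rho> \<beta> where K: "class_K_inf \<kappa>" "class_K_inf \<rho>" "class_KL \<beta>"
    and complete: "forward_complete T f"
    and bound: "\<And>t0 t x0 u. t0 \<ge> 0 \<Longrightarrow> t \<ge> t0 \<Longrightarrow> admissible_input u \<Longrightarrow>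
      ennreal (norm (flow T f t t0 x0 u)) \<le> ennreal (\<beta> (norm x0) (t - t0)) + extend_top \<rho> (input_norm \<kappa> u)"
    using assms unfolding iISS_def by metis
  have "input_norm \<kappa> (\<lambda>_. 0 :: 'u) = 0"
    using K(1) by (simp add: input_norm_def class_K_inf_def class_K_def)
  then have "extend_top \<rho> (input_norm \<kappa> (\<lambda>_. 0 :: 'u)) = 0"
    using K(2) by (simp add: extend_top_def class_K_inf_def class_K_def)
  then have "norm (flow T f t t0 x0 (\<lambda>_. 0)) \<le> \<beta> (norm x0) (t - t0)" if "t0 \<ge> 0" "t \<ge> t0" for t t0 x0
    using bound[OF that admissible_input_zero, of x0] K(3) that class_K_nonneg[of "\<lambda>r. \<beta> r (t - t0)" "norm x0"]
    by (simp add: class_KL_def ennreal_le_iff)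
  moreover have "end_time T f t0 x0 (\<lambda>_. 0) = \<infinity>" if "t0 \<ge> 0" for t0 x0
    using complete that admissible_input_zero unfolding forward_complete_def by blast
  ultimately show ?thesis
    using K(3) unfolding zero_GUAS_def by blast
qed

text \<open>Write \<open>t = n * p + r\<close> with \<open>0 \<le> r < p\<close>: each step of length \<open>p\<close> halves the norm, and
\<open>(1/2) ^ n\<close> decays exponentially in \<open>t\<close>.\<close>

lemma C0_semigroup_exponentially_stable:
  assumes T: "C0_semigroup T" and bound: "\<And>t. t \<ge> 0 \<Longrightarrow> norm (T t) \<le> B"
    and p: "p > 0" "norm (T p) \<le> 1 / 2"
  obtains M \<nu> where "M \<ge> 1" "\<nu> > 0" "\<And>t. t \<ge> 0 \<Longrightarrow> norm (T t) \<le> M * exp (- (\<nu> * t))"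
proof -
  define C where "C = max 1 B"
  have halving: "norm (T (real n * p + t)) \<le> (1 / 2) ^ n * C" if "t \<ge> 0" for n t
  proof (induction n)
    case 0
    show ?case
      using bound[OF that] by (simp add: C_def)
  next
    case (Suc n)
    have "T (p + (real n * p + t)) = T p o\<^sub>L T (real n * p + t)"
      using T p that unfolding C0_semigroup_def by simp
    then have "norm (T (real (Suc n) * p + t)) \<le> norm (T p) * norm (T (real n * p + t))"
      using norm_blinfun_compose[of "T p" "T (real n * p + t)"] by (simp add: algebra_simps)
    also have "\<dots> \<le> 1 / 2 * ((1 / 2) ^ n * C)"
      using p Suc by (intro mult_mono) auto
    finally show ?case
      by simp
  qed
  define \<nu> where "\<nu> = ln 2 / p"
  have "norm (T t) \<le> 2 * C * exp (- (\<nu> * t))" if "t \<ge> 0" for t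
  proof -
    define n where "n = nat \<lfloor>t / p\<rfloor>"
    have n: "real n \<le> t / p" "t / p \<le> real n + 1"
      using that p unfolding n_def by (auto simp: floor_less_cancel)
    have "(1 / 2) ^ n = exp (- (real n * ln 2))"
      by (simp add: exp_minus exp_of_nat_mult power_one_over inverse_eq_divide)
    also have "\<dots> \<le> exp (ln 2 - \<nu> * t)"
    proof -
      have "(t / p - 1) * ln 2 \<le> real n * ln 2"
        using n by (intro mult_right_mono) auto
      then show ?thesis
        by (simp add: \<nu>_def algebra_simps)
    qed
    also have "\<dots> = 2 * exp (- (\<nu> * t))"
      by (simp add: exp_diff exp_minus inverse_eq_divide)
    finally have decay: "(1 / 2) ^ n \<le> 2 * exp (- (\<nu> * t))" .
    have "norm (T t) \<le> (1 / 2) ^ n * C"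
      using halving[of "t - real n * p" n] n p by (simp add: field_simps)
    also have "\<dots> \<le> (2 * exp (- (\<nu> * t))) * C"
      using decay by (intro mult_right_mono) (auto simp: C_def)
    finally show ?thesis
      by (simp add: mult_ac)
  qed
  moreover have "2 * C \<ge> 1" "\<nu> > 0"
    using p by (auto simp: C_def \<nu>_def)
  ultimately show ?thesis
    using that by blast
qed

text \<open>Multiplying the variation of constants formula by \<open>e s = exp (\<nu> * (s - t0))\<close> cancels the decay of the
semigroup: \<open>z s = e s * norm (x s)\<close> obeys an integral inequality with kernel
\<open>M * K * \<gamma> (norm (u s))\<close>. Its constant term is \<open>M * norm x0\<close> plus the weighted integral of
\<open>M * d * \<gamma> (norm (u s))\<close>, which is at most \<open>M * d * e t * G\<close> because the weight is largest at the
final time. Gronwall's lemma, divided by \<open>e t\<close>, is the claim.\<close>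

lemma weak_solution_exponential_estimate:
  fixes f :: "real \<Rightarrow> 'x::banach \<Rightarrow> 'u::real_normed_vector \<Rightarrow> 'x"
  assumes T: "C0_semigroup T" and f: "SL1 f" and t0: "t0 \<ge> 0" and u: "admissible_input u"
    and growth: "\<And>t \<xi> \<mu>. t \<ge> 0 \<Longrightarrow> norm (f t \<xi> \<mu>) \<le> (K * norm \<xi> + d) * \<gamma> (norm \<mu>)"
    and "K \<ge> 0" "d \<ge> 0" and \<gamma>: "class_K \<gamma>"
    and "M \<ge> 0" "\<nu> \<ge> 0" and stable: "\<And>t. t \<ge> 0 \<Longrightarrow> norm (T t) \<le> M * exp (- (\<nu> * t))"
    and x: "weak_solution T f t0 x0 u {t0..} x" and "t0 \<le> t"
    and G_def: "G = integral {t0..t} (\<lambda>s. \<gamma> (norm (u s)))"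
  shows "norm (x t) \<le> (M * exp (- (\<nu> * (t - t0))) * norm x0 + M * d * G) * exp (M * K * G)"
proof -
  define g where "g s = \<gamma> (norm (u s))" for s
  have g_nonneg: "g s \<ge> 0" for s
    unfolding g_def by (rule class_K_nonneg[OF \<gamma>]) simp
  have g_reg: "regulated_on t0 t g"
    unfolding g_def by (rule regulated_on_gain[OF \<gamma> admissible_input_regulated[OF u t0]])
  then have g_int: "g integrable_on {t0..t}"
    by (rule regulated_on_integrable)
  define e where "e s = exp (\<nu> * (s - t0))" for s
  define z where "z s = e s * norm (x s)" for s
  have cont: "continuous_on {t0..t} x"
    using x continuous_on_subset[of "{t0..}" x "{t0..t}"] by (auto simp: weak_solution_def)
  have z_cont: "continuous_on {t0..t} z"
    unfolding z_def e_def by (intro continuous_intros cont)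
  have e_mono: "e s \<le> e r" if "s \<le> r" for s r
    using that \<open>\<nu> \<ge> 0\<close> by (simp add: e_def mult_left_mono)
  have z_bound: "z t \<le> (M * norm x0 + M * d * e t * G) * exp (integral {t0..t} (\<lambda>s. M * K * g s))"
  proof (rule gronwall[OF \<open>t0 \<le> t\<close>])
    show "(\<lambda>s. M * K * g s) integrable_on {t0..t}"
      by (rule integrable_on_mult_right[OF g_int])
    show gz: "(\<lambda>s. M * K * g s * z s) integrable_on {t0..t}"
      using integrable_on_mult_right[OF regulated_on_integrable[OF
          regulated_on_mult[OF g_reg continuous_on_imp_regulated_on[OF z_cont]]], of "M * K"]
      by (simp add: mult.assoc)
    show "M * K * g s \<ge> 0" for s
      using g_nonneg \<open>M \<ge> 0\<close> \<open>K \<ge> 0\<close> by simp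
    show "z s \<ge> 0" for s
      by (simp add: z_def e_def)
    show "z r \<le> M * norm x0 + M * d * e t * G + integral {t0..r} (\<lambda>s. M * K * g s * z s)"
      if r: "r \<in> {t0..t}" for r
    proof -
      have sub: "g integrable_on {t0..r}" "(\<lambda>s. M * K * g s * z s) integrable_on {t0..r}"
        using r by (auto intro: integrable_on_subinterval[OF g_int] integrable_on_subinterval[OF gz])
      define I where "I = integral {t0..r} (\<lambda>s. M * K * g s * z s)"
      have x_cont: "continuous_on {t0..r} x"
        using r by (intro continuous_on_subset[OF cont]) auto
      have "norm (convolution T t0 (\<lambda>s. f s (x s) (u s)) r)
          \<le> integral {t0..r} (\<lambda>s. inverse (e r) * (M * K * g s * z s + M * d * e t * g s))"
      proof (rule norm_convolution_le[OF T])
        show "regulated_on t0 r (\<lambda>s. f s (x s) (u s))"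
          by (rule regulated_on_nonlinearity[OF f t0 x_cont admissible_input_regulated[OF u t0]])
        show "(\<lambda>s. inverse (e r) * (M * K * g s * z s + M * d * e t * g s)) integrable_on {t0..r}"
          by (intro integrable_on_mult_right integrable_add sub)
        fix s assume s: "s \<in> {t0..r}"
        have "exp (- (\<nu> * (r - s))) = inverse (e r) * e s"
          unfolding e_def by (simp add: algebra_simps flip: exp_minus exp_add)
        then have "norm (T (r - s)) \<le> M * (inverse (e r) * e s)"
          using stable[of "r - s"] s by simp
        moreover have "norm (f s (x s) (u s)) \<le> (K * norm (x s) + d) * g s"
          unfolding g_def using s t0 by (intro growth) auto
        ultimately have "norm (T (r - s)) * norm (f s (x s) (u s))
            \<le> (M * (inverse (e r) * e s)) * ((K * norm (x s) + d) * g s)"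
          using \<open>M \<ge> 0\<close> by (intro mult_mono) (auto simp: e_def)
        also have "\<dots> = inverse (e r) * (M * K * g s * z s + M * d * e s * g s)"
          by (simp add: z_def algebra_simps)
        also have "\<dots> \<le> inverse (e r) * (M * K * g s * z s + M * d * e t * g s)"
          using e_mono[of s t] s r \<open>M \<ge> 0\<close> \<open>d \<ge> 0\<close> g_nonneg[of s]
          by (intro mult_left_mono add_left_mono mult_right_mono) (auto simp: e_def)
        finally show "norm (T (r - s)) * norm (f s (x s) (u s))
            \<le> inverse (e r) * (M * K * g s * z s + M * d * e t * g s)" .
      qed
      also have "\<dots> = inverse (e r) * (I + M * d * e t * integral {t0..r} g)"
        unfolding I_def
        by (simp add: Henstock_Kurzweil_Integration.integral_add[OF sub(2) integrable_on_mult_right[OF sub(1)]])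
      also have "\<dots> \<le> inverse (e r) * (I + M * d * e t * G)"
      proof -
        have "integral {t0..r} g \<le> G"
          unfolding G_def g_def[symmetric] using r g_int g_nonneg by (intro integral_mono_interval) auto
        then show ?thesis
          using \<open>M \<ge> 0\<close> \<open>d \<ge> 0\<close> by (intro mult_left_mono add_left_mono) (auto simp: e_def)
      qed
      finally have conv: "norm (convolution T t0 (\<lambda>s. f s (x s) (u s)) r)
          \<le> inverse (e r) * (I + M * d * e t * G)" .
      have lin: "norm (T (r - t0) x0) \<le> inverse (e r) * (M * norm x0)"
      proof -
        have "norm (T (r - t0) x0) \<le> (M * exp (- (\<nu> * (r - t0)))) * norm x0"
          using r by (intro order_trans[OF norm_blinfun] mult_right_mono stable) auto
        then show ?thesis
          by (simp add: e_def exp_minus mult_ac)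
      qed
      have "x r = T (r - t0) x0 + convolution T t0 (\<lambda>s. f s (x s) (u s)) r"
        using x r unfolding weak_solution_iff_convolution[OF T f t0 u] by auto
      then have "norm (x r) \<le> inverse (e r) * (M * norm x0 + M * d * e t * G + I)"
        using norm_triangle_le[OF add_mono[OF lin conv]] by (simp add: algebra_simps)
      then have "z r \<le> e r * (inverse (e r) * (M * norm x0 + M * d * e t * G + I))"
        unfolding z_def by (intro mult_left_mono) (auto simp: e_def)
      also have "\<dots> = M * norm x0 + M * d * e t * G + I"
        by (simp add: e_def)
      finally show ?thesis
        by (simp add: I_def)
    qed
  qed
  have "G = integral {t0..t} g"
    unfolding g_def G_def ..
  then have "integral {t0..t} (\<lambda>s. M * K * g s) = M * K * G"
    by simp
  note z_bound = z_bound[unfolded this]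
  have "norm (x t) = inverse (e t) * z t"
    by (simp add: z_def e_def)
  also have "\<dots> \<le> inverse (e t) * ((M * norm x0 + M * d * e t * G) * exp (M * K * G))"
    using z_bound by (intro mult_left_mono) (auto simp: e_def)
  also have "\<dots> = (M * inverse (e t) * norm x0 + M * d * G * (inverse (e t) * e t)) * exp (M * K * G)"
    by (simp add: algebra_simps)
  also have "inverse (e t) * e t = 1"
    by (simp add: e_def)
  also have "inverse (e t) = exp (- (\<nu> * (t - t0)))"
    by (simp add: e_def exp_minus)
  finally show ?thesis
    by simp
qed

lemma integral_le_input_norm:
  assumes "class_K \<kappa>" and "t0 \<ge> 0" and "(\<lambda>s. \<kappa> (norm (u s))) integrable_on {t0..t}"
  shows "ennreal (integral {t0..t} (\<lambda>s. \<kappa> (norm (u s)))) \<le> input_norm \<kappa> u"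
proof -
  have "ennreal (integral {t0..t} (\<lambda>s. \<kappa> (norm (u s)))) =
      (\<integral>\<^sup>+ s. ennreal (indicator {t0..t} s * \<kappa> (norm (u s))) \<partial>lebesgue)"
    using nn_integral_has_integral_lebesgue[OF _ integrable_integral[OF assms(3)]] class_K_nonneg[OF assms(1)]
    by (simp add: nn_integral_completion)
  also have "\<dots> \<le> input_norm \<kappa> u"
    unfolding input_norm_def using \<open>t0 \<ge> 0\<close>
    by (intro nn_integral_mono) (auto simp: indicator_def)
  finally show ?thesis .
qed

text \<open>With zero input and vanishing \<open>f t \<xi> 0\<close> the flow is the semigroup itself. By linearity the bound
\<open>\<beta> (norm \<xi>) t\<close> on the unit sphere is a bound \<open>\<beta> 1 t\<close> on the operator norm, which is bounded in \<open>t\<close> and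
eventually below \<open>1/2\<close>.\<close>

lemma zero_GUAS_imp_exponentially_stable:
  fixes f :: "real \<Rightarrow> 'x::banach \<Rightarrow> 'u::real_normed_vector \<Rightarrow> 'x"
  assumes T: "C0_semigroup T" and f: "SL1 f" "SL2 f" and f0: "\<And>t \<xi>. t \<ge> 0 \<Longrightarrow> f t \<xi> 0 = 0"
    and stable: "zero_GUAS T f"
  obtains M \<nu> where "M \<ge> 1" "\<nu> > 0" "\<And>t. t \<ge> 0 \<Longrightarrow> norm (T t) \<le> M * exp (- (\<nu> * t))"
proof -
  obtain \<beta> where \<beta>: "class_KL \<beta>"
    and bound: "\<And>t x0. t \<ge> 0 \<Longrightarrow> norm (flow T f t 0 x0 (\<lambda>_. 0)) \<le> \<beta> (norm x0) t"
    using stable unfolding zero_GUAS_def by force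
  have solution: "weak_solution T f 0 x0 (\<lambda>_. 0) {0..} (\<lambda>t. T t x0)" for x0
    unfolding weak_solution_iff_convolution[OF T f(1) order_refl admissible_input_zero]
  proof (intro conjI ballI)
    show "solution_interval 0 {0..}"
      unfolding solution_interval_def half_open_interval_infinity[symmetric] by (intro disjI1 exI[of _ \<infinity>]) simp
    show "continuous_on {0..} (\<lambda>t. T t x0)"
      by (rule C0_semigroup_orbit_continuous[OF T])
    fix t :: real
    have "convolution T 0 (\<lambda>s. f s (T s x0) 0) t = integral {0..t} (\<lambda>_. 0)"
      unfolding convolution_def by (intro integral_cong) (simp add: f0)
    then show "T t x0 = T (t - 0) x0 + convolution T 0 (\<lambda>s. f s (T s x0) 0) t"
      by simp
  qed
  have orbit: "norm (T t x0) \<le> \<beta> (norm x0) t" if "t \<ge> 0" for t x0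
    using global_weak_solution_flow(2)[OF T f order_refl admissible_input_zero solution that] bound[OF that]
    by metis
  have norm_T: "norm (T t) \<le> \<beta> 1 t" if "t \<ge> 0" for t
  proof (rule norm_blinfun_bound)
    show "0 \<le> \<beta> 1 t"
      using \<beta> that class_K_nonneg[of "\<lambda>r. \<beta> r t" 1] by (simp add: class_KL_def)
    fix \<xi>
    show "norm (T t \<xi>) \<le> \<beta> 1 t * norm \<xi>"
    proof (cases "\<xi> = 0")
      case False
      have "norm (T t \<xi>) = norm (T t (\<xi> /\<^sub>R norm \<xi>)) * norm \<xi>"
        using False by (simp add: blinfun.scaleR_right)
      also have "\<dots> \<le> \<beta> 1 t * norm \<xi>"
        using orbit[OF that, of "\<xi> /\<^sub>R norm \<xi>"] False by (intro mult_right_mono) auto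
      finally show ?thesis .
    qed simp
  qed
  have "antimono_on {0..} (\<beta> 1)" and lim: "(\<beta> 1 \<longlongrightarrow> 0) at_top"
    using \<beta> by (auto simp: class_KL_def)
  then have "norm (T t) \<le> \<beta> 1 0" if "t \<ge> 0" for t
    using norm_T[OF that] that monotone_onD[of "{0..}" "(\<le>)" "(\<ge>)" "\<beta> 1" 0 t] by force
  moreover have "\<forall>\<^sub>F t in at_top. \<beta> 1 t < 1 / 2"
    using order_tendstoD(2)[OF lim, of "1 / 2"] by simp
  then obtain p where "p > 0" "\<beta> 1 p < 1 / 2"
    using eventually_happens'[OF _ eventually_conj[OF eventually_gt_at_top[of 0]]] by (metis trivial_limit_at_top_linorder)
  then have "p > 0" "norm (T p) \<le> 1 / 2"
    using norm_T[of p] by auto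
  ultimately show ?thesis
    using C0_semigroup_exponentially_stable[OF T] that by blast
qed

text \<open>The transient bound \<open>y + y\<^sup>2 / 2\<close> for \<open>y = M * exp (- \<nu> * t) * r\<close> that the final estimate produces.\<close>

lemma class_KL_exponential:
  assumes "M > 0" "\<nu> > 0"
  shows "class_KL (\<lambda>r t. M * exp (- (\<nu> * t)) * r + (M * exp (- (\<nu> * t)) * r)\<^sup>2 / 2)"
  unfolding class_KL_def
proof (intro conjI allI impI)
  fix t :: real
  define c where "c = M * exp (- (\<nu> * t))"
  have "c > 0"
    using assms by (simp add: c_def)
  have "strict_mono_on {0..} (\<lambda>r. c * r + (c * r)\<^sup>2 / 2)"
  proof (rule strict_mono_onI)
    fix r s :: real
    assume "r \<in> {0..}" "s \<in> {0..}" "r < s"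
    then have "c * r < c * s" "(c * r)\<^sup>2 \<le> (c * s)\<^sup>2"
      using \<open>c > 0\<close> by (auto intro!: power_mono)
    then show "c * r + (c * r)\<^sup>2 / 2 < c * s + (c * s)\<^sup>2 / 2"
      by linarith
  qed
  moreover have "continuous_on {0..} (\<lambda>r. c * r + (c * r)\<^sup>2 / 2)"
    by (intro continuous_intros) simp
  ultimately show "class_K (\<lambda>r. M * exp (- (\<nu> * t)) * r + (M * exp (- (\<nu> * t)) * r)\<^sup>2 / 2)"
    unfolding c_def[symmetric] by (simp add: class_K_def)
next
  fix r :: real
  assume "r \<ge> 0"
  have "M * exp (- (\<nu> * t)) * r + (M * exp (- (\<nu> * t)) * r)\<^sup>2 / 2 \<le>
      M * exp (- (\<nu> * s)) * r + (M * exp (- (\<nu> * s)) * r)\<^sup>2 / 2" if "s \<le> t" for s t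
  proof -
    have "M * exp (- (\<nu> * t)) * r \<le> M * exp (- (\<nu> * s)) * r"
      using that assms \<open>r \<ge> 0\<close> by (intro mult_right_mono mult_left_mono) auto
    then show ?thesis
      using assms \<open>r \<ge> 0\<close> by (intro add_mono divide_right_mono power_mono) auto
  qed
  then show "antimono_on {0..} (\<lambda>t. M * exp (- (\<nu> * t)) * r + (M * exp (- (\<nu> * t)) * r)\<^sup>2 / 2)"
    by (intro monotone_onI)
  have "filterlim (\<lambda>t. - (\<nu> * t)) at_bot at_top"
    using filterlim_tendsto_pos_mult_at_top[OF tendsto_const \<open>\<nu> > 0\<close> filterlim_ident]
    by (simp add: filterlim_uminus_at_top)
  then have "((\<lambda>t. exp (- (\<nu> * t))) \<longlongrightarrow> 0) at_top"
    by (rule filterlim_compose[OF exp_at_bot])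
  then have "((\<lambda>t. M * exp (- (\<nu> * t)) * r + (M * exp (- (\<nu> * t)) * r)\<^sup>2 / 2) \<longlongrightarrow>
      M * 0 * r + (M * 0 * r)\<^sup>2 / 2) at_top"
    by (intro tendsto_intros) auto
  then show "((\<lambda>t. M * exp (- (\<nu> * t)) * r + (M * exp (- (\<nu> * t)) * r)\<^sup>2 / 2) \<longlongrightarrow> 0) at_top"
    by simp
qed

text \<open>The gain that the final estimate produces. The summand \<open>G\<close> makes it strictly increasing and
unbounded even if \<open>p\<close> and \<open>q\<close> are zero.\<close>

lemma class_K_inf_exponential_gain:
  assumes "p \<ge> 0" "q \<ge> 0"
  shows "class_K_inf (\<lambda>G. (exp (p * G) - 1)\<^sup>2 / 2 + q * G * exp (p * G) + G)"
proof -
  define \<rho> where "\<rho> G = (exp (p * G) - 1)\<^sup>2 / 2 + q * G * exp (p * G) + G" for G :: real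
  have "strict_mono_on {0..} \<rho>"
  proof (rule strict_mono_onI)
    fix G H :: real
    assume GH: "G \<in> {0..}" "H \<in> {0..}" "G < H"
    have e: "1 \<le> exp (p * G)" "exp (p * G) \<le> exp (p * H)"
      using GH assms by (auto simp: mult_left_mono)
    then have "(exp (p * G) - 1)\<^sup>2 \<le> (exp (p * H) - 1)\<^sup>2"
      by (intro power_mono) auto
    moreover have "q * G * exp (p * G) \<le> q * H * exp (p * H)"
      using e GH assms by (intro mult_mono) auto
    ultimately show "\<rho> G < \<rho> H"
      using GH unfolding \<rho>_def by linarith
  qed
  moreover have "continuous_on {0..} \<rho>"
    unfolding \<rho>_def by (intro continuous_intros) auto
  moreover have "\<not> bdd_above (\<rho> ` {0..})"
  proof
    assume "bdd_above (\<rho> ` {0..})"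
    then obtain C where C: "\<And>G. G \<ge> 0 \<Longrightarrow> \<rho> G \<le> C"
      by (auto simp: bdd_above_def)
    have "G \<le> \<rho> G" if "G \<ge> 0" for G
      using that assms by (simp add: \<rho>_def)
    then show False
      using C[of "\<bar>C\<bar> + 1"] by (smt (verit))
  qed
  moreover have "\<rho> 0 = 0"
    by (simp add: \<rho>_def)
  ultimately show ?thesis
    unfolding \<rho>_def[symmetric] class_K_inf_def class_K_def by simp
qed

theorem theorem5p2:
  fixes D :: "'x::banach set"
    and A :: "'x \<Rightarrow> 'x"
    and T :: "real \<Rightarrow> 'x \<Rightarrow>\<^sub>L 'x"
    and f :: "real \<Rightarrow> 'x \<Rightarrow> 'u::real_normed_vector \<Rightarrow> 'x"
    and K d :: real
    and \<gamma> :: "real \<Rightarrow> real"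
  assumes "generates D A T"
    and "SL1 f"
    and "SL2 f"
    and "K \<ge> 0" and "d \<ge> 0"
    and "class_K_inf \<gamma>"
    and "\<And>t \<xi> \<mu>. t \<ge> 0 \<Longrightarrow> norm (f t \<xi> \<mu>) \<le> (K * norm \<xi> + d) * \<gamma> (norm \<mu>)"
  shows "iISS T f \<longleftrightarrow> zero_GUAS T f"
proof
  assume "iISS T f"
  then show "zero_GUAS T f"
    by (rule iISS_imp_zero_GUAS)
next
  assume guas: "zero_GUAS T f"
  have T: "C0_semigroup T"
    using assms(1) by (simp add: generates_def)
  have \<gamma>: "class_K \<gamma>"
    using assms(6) by (simp add: class_K_inf_def)
  note \<gamma>_mono = class_K_mono[OF \<gamma>] and \<gamma>_nonneg = class_K_nonneg[OF \<gamma>]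
  have "f t \<xi> 0 = 0" if "t \<ge> 0" for t \<xi>
    using assms(7)[OF that, of \<xi> 0] \<gamma> by (simp add: class_K_def)
  then obtain M \<nu> where "M \<ge> 1" "\<nu> > 0"
    and stable: "\<And>t. t \<ge> 0 \<Longrightarrow> norm (T t) \<le> M * exp (- (\<nu> * t))"
    using zero_GUAS_imp_exponentially_stable[OF T assms(2,3) _ guas] by blast
  have linear_growth: "\<exists>c\<ge>0. \<forall>t\<ge>0. \<forall>\<xi> \<mu>. norm \<mu> \<le> B \<longrightarrow> norm (f t \<xi> \<mu>) \<le> c * (norm \<xi> + 1)" for B
  proof (intro exI conjI allI impI)
    show "0 \<le> (K + d) * \<gamma> (max 0 B)"
      using assms(4,5) \<gamma>_nonneg by simp
    fix t :: real and \<xi> :: 'x and \<mu> :: 'u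
    assume "0 \<le> t" "norm \<mu> \<le> B"
    have "norm (f t \<xi> \<mu>) \<le> (K * norm \<xi> + d) * \<gamma> (norm \<mu>)"
      by (rule assms(7)[OF \<open>0 \<le> t\<close>])
    also have "\<dots> \<le> ((K + d) * (norm \<xi> + 1)) * \<gamma> (max 0 B)"
      using assms(4,5) \<open>norm \<mu> \<le> B\<close> \<gamma>_nonneg
      by (intro mult_mono \<gamma>_mono) (auto simp: algebra_simps)
    finally show "norm (f t \<xi> \<mu>) \<le> (K + d) * \<gamma> (max 0 B) * (norm \<xi> + 1)"
      by (simp add: mult_ac)
  qed
  define \<beta> where "\<beta> r t = M * exp (- (\<nu> * t)) * r + (M * exp (- (\<nu> * t)) * r)\<^sup>2 / 2" for r t
  define \<rho> where "\<rho> G = (exp (M * K * G) - 1)\<^sup>2 / 2 + M * d * G * exp (M * K * G) + G" for G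
  have \<beta>: "class_KL \<beta>"
    unfolding \<beta>_def using \<open>M \<ge> 1\<close> \<open>\<nu> > 0\<close> by (intro class_KL_exponential) auto
  have \<rho>: "class_K_inf \<rho>"
    unfolding \<rho>_def using \<open>M \<ge> 1\<close> assms(4,5) by (intro class_K_inf_exponential_gain) auto
  have solution: "end_time T f t0 x0 u = \<infinity> \<and> (\<forall>t\<ge>t0. ennreal (norm (flow T f t t0 x0 u))
      \<le> ennreal (\<beta> (norm x0) (t - t0)) + extend_top \<rho> (input_norm \<gamma> u))"
    if t0: "t0 \<ge> 0" and u: "admissible_input u" for t0 x0 u
  proof -
    obtain x where x: "weak_solution T f t0 x0 u {t0..} x"
      using weak_solution_exists_global[OF T assms(2,3) t0 u linear_growth] by blast
    note flow = global_weak_solution_flow[OF T assms(2,3) t0 u x]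
    have "ennreal (norm (x t)) \<le> ennreal (\<beta> (norm x0) (t - t0)) + extend_top \<rho> (input_norm \<gamma> u)"
      if "t0 \<le> t" for t
    proof (cases "input_norm \<gamma> u = \<infinity>")
      case True
      then show ?thesis
        by (simp add: extend_top_def)
    next
      case False
      define N where "N = enn2real (input_norm \<gamma> u)"
      have N: "ennreal N = input_norm \<gamma> u" "N \<ge> 0"
        using False by (auto simp: N_def less_top)
      define G where "G = integral {t0..t} (\<lambda>s. \<gamma> (norm (u s)))"
      have int: "(\<lambda>s. \<gamma> (norm (u s))) integrable_on {t0..t}"
        by (rule regulated_on_integrable[OF regulated_on_gain[OF \<gamma> admissible_input_regulated[OF u t0]]])
      have "G \<ge> 0"
        unfolding G_def by (intro integral_nonneg int \<gamma>_nonneg) simp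
      have "ennreal G \<le> ennreal N"
        using integral_le_input_norm[OF \<gamma> t0 int] by (simp add: G_def N)
      then have "G \<le> N"
        using ennreal_le_iff[OF N(2)] by blast
      define y where "y = M * exp (- (\<nu> * (t - t0))) * norm x0"
      define E where "E = exp (M * K * G)"
      have "norm (x t) \<le> (y + M * d * G) * E"
        unfolding y_def E_def
        using \<open>M \<ge> 1\<close> \<open>\<nu> > 0\<close> assms(4,5)
        by (intro weak_solution_exponential_estimate[OF T assms(2) t0 u assms(7) _ _ \<gamma> _ _ stable x that G_def]) auto
      also have "\<dots> = y + y * (E - 1) + M * d * G * E"
        by (simp add: algebra_simps)
      \<comment> \<open>The product of the decaying term and the input term is split into one summand of class KL
        and one that is absorbed by the gain.\<close>
      also have "y * (E - 1) \<le> y\<^sup>2 / 2 + (E - 1)\<^sup>2 / 2"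
        using sum_squares_bound[of y "E - 1"] by simp
      finally have "norm (x t) \<le> \<beta> (norm x0) (t - t0) + \<rho> G"
        using \<open>G \<ge> 0\<close> by (simp add: \<beta>_def \<rho>_def y_def E_def)
      also have "\<rho> G \<le> \<rho> N"
        using class_K_mono[of \<rho> G N] \<rho> \<open>G \<ge> 0\<close> \<open>G \<le> N\<close> by (simp add: class_K_inf_def)
      finally have "norm (x t) \<le> \<beta> (norm x0) (t - t0) + \<rho> N"
        by simp
      moreover have "\<beta> (norm x0) (t - t0) \<ge> 0"
        unfolding \<beta>_def using \<open>M \<ge> 1\<close> by simp
      moreover have "\<rho> N \<ge> 0"
        using class_K_nonneg[of \<rho> N] \<rho> N by (simp add: class_K_inf_def)
      ultimately have "ennreal (norm (x t)) \<le> ennreal (\<beta> (norm x0) (t - t0)) + ennreal (\<rho> N)"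
        by (simp add: ennreal_leI flip: ennreal_plus)
      then show ?thesis
        using False by (simp add: extend_top_def N_def)
    qed
    then show ?thesis
      using flow by simp
  qed
  show "iISS T f"
    unfolding iISS_def forward_complete_def
    using solution \<beta> \<rho> assms(6) by blast
qed

end
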